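(* Let $F:\mathbb{N}\to\mathbb{N}$ be a non-decreasing function such that: (A) there exist $C,\epsilon>0$ such that for all $n\in\mathbb{N}$ with $n\ge 3$, $F(n)\geq \exp\left(C\,n\,(\log n)^2(\log\log n)^{1+\epsilon}\right)$; (B) there exist a real number $C_1>1$ and an integer $C_2>1$ such that for all $n\in\mathbb{N}$, $F(n)^{C_1}\leq F(C_2n)$. Then there exists a conjugacy separable group $G$, generated by a finite set $S$, such that $F(n)\simeq \mathrm{Conj}_G^S(n)$.
   Context: $\mathbb{N}=\{1,2,3,\dots\}$. A group $G$ is conjugacy separable if for every pair of non-conjugate $g_1,g_2\in G$ there is a homomorphism $\varphi$ from $G$ onto a finite group such that $\varphi(g_1),\varphi(g_2)$ are non-conjugate. For such $G$ and $g_1,g_2\in G$ put $\mathrm{Conj}_G(g_1,g_2)=1$ if $g_1,g_2$ are conjugate in $G$, and otherwise $\mathrm{Conj}_G(g_1,g_2)=\min\{[G:N] : N\text{ normal of finite index in } G,\ g_1N \text{ and } g_2N \text{ not conjugate in } G/N\}$. For a finite generating set $S$ of $G$ with word norm $\|\cdot\|_S$, $\mathrm{Conj}_G^S(n)=\max\{\mathrm{Conj}_G(g_1,g_2): \|g_1\|_S\le n,\ \|g_2\|_S\leq n\}$ for $n\in\mathbb{N}$. For non-decreasing $f,g:\mathbb{N}\to\mathbb{R}_{>0}$, write $f\prec g$ if there is a constant $c\in\mathbb{N}$ with $f(n)\leq g(cn)$ for all $n\in\mathbb N$, and $f\simeq g$ if $f\prec g$ and $g\prec f$. *)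

theory Defs
  imports Complex_Main "HOL-Algebra.Coset" "HOL-Algebra.Generated_Groups"
begin

definition conjugate_in :: "('a, 'b) monoid_scheme \<Rightarrow> 'a \<Rightarrow> 'a \<Rightarrow> bool" where
  "conjugate_in G x y \<longleftrightarrow>
     (\<exists>h \<in> carrier G. y = h \<otimes>\<^bsub>G\<^esub> x \<otimes>\<^bsub>G\<^esub> inv\<^bsub>G\<^esub> h)"

text \<open>The finite quotients are taken on the type \<^typ>\<open>nat\<close>; this loses nothing, as every
  finite group has an isomorphic copy there.\<close>

definition conjugacy_separable :: "('a, 'b) monoid_scheme \<Rightarrow> bool" where
  "conjugacy_separable G \<longleftrightarrow>
     (\<forall>x \<in> carrier G. \<forall>y \<in> carrier G. \<not> conjugate_in G x y \<longrightarrow>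
        (\<exists>(H :: nat monoid) \<phi>. group H \<and> finite (carrier H) \<and> \<phi> \<in> epi G H \<and>
           \<not> conjugate_in H (\<phi> x) (\<phi> y)))"

text \<open>The index of \<open>N\<close> is the number of its cosets. \<open>G Mod N\<close> consists of right cosets, which
  are the left cosets as \<open>N\<close> is normal. In a conjugacy separable group the predicate under
  \<open>LEAST\<close> is satisfiable, so the minimum is attained.\<close>

definition Conj_elt :: "('a, 'b) monoid_scheme \<Rightarrow> 'a \<Rightarrow> 'a \<Rightarrow> nat" where
  "Conj_elt G x y =
     (if conjugate_in G x y then 1
      else (LEAST k. \<exists>N. N \<lhd> G \<and> finite (rcosets\<^bsub>G\<^esub> N) \<and> k = card (rcosets\<^bsub>G\<^esub> N) \<and>
              \<not> conjugate_in (G Mod N) (N #>\<^bsub>G\<^esub> x) (N #>\<^bsub>G\<^esub> y)))"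

definition word_norm :: "('a, 'b) monoid_scheme \<Rightarrow> 'a set \<Rightarrow> 'a \<Rightarrow> nat" where
  "word_norm G S g =
     (LEAST k. \<exists>w. set w \<subseteq> S \<union> (\<lambda>s. inv\<^bsub>G\<^esub> s) ` S \<and> length w = k \<and>
        foldr (\<otimes>\<^bsub>G\<^esub>) w \<one>\<^bsub>G\<^esub> = g)"

text \<open>For a finite generating set the balls are finite and contain the identity, so the
  maximum is over a finite nonempty set.\<close>

definition Conj_fun :: "('a, 'b) monoid_scheme \<Rightarrow> 'a set \<Rightarrow> nat \<Rightarrow> nat" where
  "Conj_fun G S n =
     Max {Conj_elt G x y | x y. x \<in> carrier G \<and> y \<in> carrier G \<and>
            word_norm G S x \<le> n \<and> word_norm G S y \<le> n}"

text \<open>Functions on the positive integers are represented by functions on \<^typ>\<open>nat\<close> whose value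
  at \<open>0\<close> is ignored.\<close>

definition growth_le :: "(nat \<Rightarrow> real) \<Rightarrow> (nat \<Rightarrow> real) \<Rightarrow> bool" where
  "growth_le f g \<longleftrightarrow> (\<exists>c::nat. c \<ge> 1 \<and> (\<forall>n\<ge>1. f n \<le> g (c * n)))"

definition growth_equiv :: "(nat \<Rightarrow> real) \<Rightarrow> (nat \<Rightarrow> real) \<Rightarrow> bool" where
  "growth_equiv f g \<longleftrightarrow> growth_le f g \<and> growth_le g f"

end

theory Submission
  imports Defs "HOL-Library.Poly_Mapping" "HOL-Library.Z2" "HOL-Library.Countable"
    "HOL-Number_Theory.Cong"
begin

text \<open>
  Let \<open>R\<close> be the ring of Laurent polynomials over the two-element field, and fix powers of two
  \<open>n\<^sub>i = 2^\<nu>(i)\<close> and \<open>m\<^sub>i = 2^\<mu>(i)\<close> with \<open>m\<^sub>i \<ge> 4 n\<^sub>i\<close> and \<open>m\<^bsub>i+1\<^esub> \<ge> 64 m\<^sub>i\<close>. Extend the lamplighter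
  group \<open>R \<rtimes> \<int>\<close> by a central elementary abelian 2-group with basis \<open>e\<^sub>0, e\<^sub>1, \<dots>\<close> such that the
  commutator of the lamps at positions \<open>0\<close> and \<open>k\<close> has \<open>i\<close>-th coordinate \<open>1\<close> iff
  \<open>k \<equiv> \<plusminus>n\<^sub>i (mod m\<^sub>i)\<close>. Then \<open>e\<^sub>i\<close> is the commutator of the lamps at \<open>0\<close> and \<open>n\<^sub>i\<close>, hence has length
  \<open>O(n\<^sub>i)\<close>.

  The central fact is that every nonzero \<open>f \<in> R\<close> of degree less than \<open>m\<^sub>i / 16\<close> has \<open>e\<^sub>i\<close> among its
  commutators with lamp configurations. A finite quotient of order less than \<open>2^(m\<^sub>i / 16)\<close> kills
  such an \<open>f\<close> by the pigeonhole principle, so it kills \<open>e\<^sub>i\<close>. Conversely, for elements of length at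
  most \<open>n\<close> the same fact reduces conjugacy to the coordinates with \<open>n\<^sub>i = O(n)\<close>, which are seen in a
  quotient in which shift and lamps are taken modulo a power of two \<open>M = O(max n m\<^sub>i)\<close>; elements with
  a nonzero shift \<open>k\<close> need in addition the lamplighter quotient modulo \<open>k\<close>. Choosing \<open>m\<^sub>i\<close>
  proportional to \<open>log F(L n\<^sub>i)\<close> for a large constant \<open>L\<close> matches both bounds with \<open>F\<close>.
\<close>

section \<open>Laurent polynomials over the two-element field\<close>

abbreviation keys :: "('a \<Rightarrow>\<^sub>0 'b::zero) \<Rightarrow> 'a set"
  where "keys \<equiv> Poly_Mapping.keys"

abbreviation lookup :: "('a \<Rightarrow>\<^sub>0 'b::zero) \<Rightarrow> 'a \<Rightarrow> 'b"
  where "lookup \<equiv> Poly_Mapping.lookup"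

abbreviation T :: "int \<Rightarrow> int \<Rightarrow>\<^sub>0 bit"
  where "T k \<equiv> Poly_Mapping.single k 1"

section \<open>Arithmetic in characteristic two\<close>

lemma f2_add_self [simp]: "f + f = (0 :: 'c \<Rightarrow>\<^sub>0 bit)"
  by (rule poly_mapping_eqI) (simp only: lookup_add lookup_zero, metis add.inverse_inverse ab_group_add_class.ab_left_minus bit_not_zero_iff add.right_neutral one_add_one bit_2_eq_0)

lemma f2_uminus [simp]: "- f = (f :: 'c \<Rightarrow>\<^sub>0 bit)"
  by (rule minus_unique) simp

lemma f2_minus [simp]: "f - g = f + (g :: 'c \<Rightarrow>\<^sub>0 bit)"
  by (metis diff_conv_add_uminus f2_uminus)

lemma f2_add_cancel_left [simp]: "f + (f + g) = (g :: 'c \<Rightarrow>\<^sub>0 bit)"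
  by (metis add.assoc add_0 f2_add_self)

lemma f2_add_eq_0_iff [simp]: "f + g = 0 \<longleftrightarrow> f = (g :: 'c \<Rightarrow>\<^sub>0 bit)"
  by (metis f2_minus right_minus_eq)

lemma f2_mult_2 [simp]: "2 * f = (0 :: 'c::monoid_add \<Rightarrow>\<^sub>0 bit)"
  by (simp only: mult_2 f2_add_self)

lemma lookup_f2: "lookup (f :: 'c \<Rightarrow>\<^sub>0 bit) k = (if k \<in> keys f then 1 else 0)"
  by (auto simp: in_keys_iff)

lemma keys_f2_inject: "keys f = keys g \<longleftrightarrow> f = (g :: 'c \<Rightarrow>\<^sub>0 bit)"
  by (auto intro!: poly_mapping_eqI simp: lookup_f2)

lemma keys_add_f2: "keys (f + g) = (keys f - keys g) \<union> (keys g - keys (f :: 'c \<Rightarrow>\<^sub>0 bit))"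
  by (auto simp: in_keys_iff lookup_add bit_not_zero_iff simp del: add_bit_eq_xor)

lemma f2_induct [case_names zero add]:
  fixes f :: "'c \<Rightarrow>\<^sub>0 bit"
  assumes "P 0" and "\<And>k f. k \<notin> keys f \<Longrightarrow> P f \<Longrightarrow> P (Poly_Mapping.single k 1 + f)"
  shows "P f"
proof -
  have "P f" if "finite K" "keys f = K" for K and f :: "'c \<Rightarrow>\<^sub>0 bit"
    using that
  proof (induction K arbitrary: f)
    case empty
    then show ?case using assms(1) keys_f2_inject[of f 0] by simp
  next
    case (insert k K)
    let ?g = "Poly_Mapping.single k 1 + f"
    have "keys ?g = K" using insert by (auto simp: keys_add_f2)
    then have "k \<notin> keys ?g" "P ?g" using insert.hyps(2) insert.IH[of ?g] by simp_all
    then have "P (Poly_Mapping.single k 1 + ?g)" by (rule assms(2))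
    then show ?case by simp
  qed
  then show ?thesis using finite_keys[of f] by blast
qed

text \<open>The linear extension of \<open>T k\<close> -> \<open>w k\<close>: over two elements a
  polynomial is the sum of the monomials in its support.\<close>

definition lin :: "(int \<Rightarrow> 'c \<Rightarrow>\<^sub>0 bit) \<Rightarrow> (int \<Rightarrow>\<^sub>0 bit) \<Rightarrow> 'c \<Rightarrow>\<^sub>0 bit"
  where "lin w f = (\<Sum>k\<in>keys f. w k)"

lemma lin_0 [simp]: "lin w 0 = 0"
  by (simp add: lin_def)

lemma lin_T [simp]: "lin w (T k) = w k"
  by (simp add: lin_def)

text \<open>The support of a sum is the symmetric difference of the supports; common terms
  contribute twice and cancel.\<close>

lemma lin_add: "lin w (f + g) = lin w f + lin w g"
proof -
  have "sum w (keys f) = sum w (keys f - keys g) + sum w (keys f \<inter> keys g)" for f g :: "int \<Rightarrow>\<^sub>0 bit"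
    by (subst sum.union_disjoint[symmetric]) (auto intro!: sum.cong)
  from this[of f g] this[of g f] show ?thesis
    unfolding lin_def keys_add_f2
    by (subst sum.union_disjoint) (auto simp: Int_commute algebra_simps)
qed

lemma additive_ext:
  fixes F G :: "(int \<Rightarrow>\<^sub>0 bit) \<Rightarrow> 'c \<Rightarrow>\<^sub>0 bit"
  assumes "\<And>f g. F (f + g) = F f + F g" "\<And>f g. G (f + g) = G f + G g" "\<And>k. F (T k) = G (T k)"
  shows "F f = G f"
proof (induction f rule: f2_induct)
  case zero
  have "F 0 = 0" "G 0 = 0" using assms(1)[of 0 0] assms(2)[of 0 0] by auto
  then show ?case by simp
next
  case (add k f)
  then show ?case using assms by simp
qed

lemma T_mult: "T a * T b = T (a + b)"
  by (simp add: mult_single)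

lemma T_mult_left: "T a * (T b * f) = T (a + b) * f"
  by (simp add: mult_single mult.assoc[symmetric])

lemma lookup_T_mult: "lookup (T a * f) x = lookup f (x - a)"
proof (induction f rule: f2_induct)
  case (add k f)
  then show ?case by (simp add: distrib_left lookup_add mult_single lookup_single when_def algebra_simps
     del: add_bit_eq_xor)
qed simp

lemma keys_T_mult: "keys (T a * f) = (+) a ` keys f"
proof -
  have "x \<in> (+) a ` keys f \<longleftrightarrow> x - a \<in> keys f" for x
    by (force simp: image_iff)
  then show ?thesis by (auto simp: in_keys_iff lookup_T_mult)
qed

text \<open>The involution t -> 1/t of the group ring. In \<open>star f * g\<close> the exponents
  are the differences between positions in \<open>g\<close> and positions in
  \<open>f\<close>.\<close>

definition star :: "(int \<Rightarrow>\<^sub>0 bit) \<Rightarrow> int \<Rightarrow>\<^sub>0 bit"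
  where "star = lin (\<lambda>k. T (- k))"

lemma star_add: "star (f + g) = star f + star g"
  by (simp add: star_def lin_add)

lemma star_0 [simp]: "star 0 = 0" and star_T [simp]: "star (T k) = T (- k)"
  and star_1 [simp]: "star 1 = 1"
  using lin_T[of "\<lambda>k. T (- k)" 0] by (simp_all add: star_def)

lemma star_mult: "star (f * g) = star f * star g"
proof -
  have *: "star (T k * g) = T (- k) * star g" for k g
    by (rule additive_ext[of "\<lambda>g. star (T k * g)"]) (auto simp: star_add distrib_left mult_single)
  show ?thesis
    by (rule additive_ext[of "\<lambda>f. star (f * g)"]) (auto simp: star_add distrib_right *)
qed

lemma star_star [simp]: "star (star f) = f"
  by (rule additive_ext[of "\<lambda>f. star (star f)"]) (auto simp: star_add)

lemma keys_star: "keys (star f) = uminus ` keys f"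
proof -
  have "k \<in> keys (star f) \<longleftrightarrow> - k \<in> keys f" for k
  proof (induction f rule: f2_induct)
    case (add j f)
    then show ?case by (auto simp: star_add keys_add_f2)
  qed simp
  then show ?thesis by (force simp: image_iff)
qed

text \<open>Congruence modulo \<open>t^M - 1\<close>; signs do not matter in characteristic 2.\<close>
definition cg :: "int \<Rightarrow> (int \<Rightarrow>\<^sub>0 bit) \<Rightarrow> (int \<Rightarrow>\<^sub>0 bit) \<Rightarrow> bool"
  where "cg M f g \<longleftrightarrow> T M + 1 dvd f + g"

lemma cg_refl [simp]: "cg M f f"
  by (simp add: cg_def)

lemma cg_sym: "cg M f g \<Longrightarrow> cg M g f"
  by (simp add: cg_def add.commute)

lemma cg_trans [trans]: "cg M f g \<Longrightarrow> cg M g h \<Longrightarrow> cg M f h"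
proof -
  assume "cg M f g" "cg M g h"
  then have "T M + 1 dvd (f + g) + (g + h)" unfolding cg_def by (rule dvd_add)
  also have "(f + g) + (g + h) = f + h" by (simp add: add.assoc)
  finally show ?thesis by (simp add: cg_def)
qed

lemma cg_add: "cg M f g \<Longrightarrow> cg M f' g' \<Longrightarrow> cg M (f + f') (g + g')"
  unfolding cg_def by (drule (1) dvd_add) (simp add: algebra_simps)

lemma cg_mult_left: "cg M f g \<Longrightarrow> cg M (h * f) (h * g)"
  unfolding cg_def by (metis distrib_left dvd_mult)

lemma cg_mult: "cg M f g \<Longrightarrow> cg M f' g' \<Longrightarrow> cg M (f * f') (g * g')"
  by (metis cg_mult_left cg_trans mult.commute)

lemma T_plus_1_dvd_nat: "T M + 1 dvd T (M * int u) + 1"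
proof (induction u)
  case (Suc u)
  have "T (M * int (Suc u)) + 1 = T M * (T (M * int u) + 1) + (T M + 1)"
    by (simp add: T_mult algebra_simps)
  then show ?case using Suc by (metis dvd_add dvd_mult dvd_refl)
qed simp

lemma T_plus_1_dvd: "M dvd k \<Longrightarrow> T M + 1 dvd T k + 1"
proof -
  assume "M dvd k"
  then obtain u where k: "k = M * u" by auto
  show ?thesis
  proof (cases "u \<ge> 0")
    case True
    then show ?thesis using T_plus_1_dvd_nat[of M "nat u"] k by simp
  next
    case False
    have "T k + 1 = T k * (T (M * int (nat (- u))) + 1)"
      using False k by (simp add: T_mult algebra_simps)
    then show ?thesis using T_plus_1_dvd_nat[of M "nat (- u)"] by (metis dvd_mult)
  qed
qed

lemma cg_T: "cg M (T a) (T b)" if "M dvd a - b"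
proof -
  have "T a + T b = T b * (T (a - b) + 1)" by (simp add: T_mult algebra_simps)
  then show ?thesis unfolding cg_def using T_plus_1_dvd[OF that] by (metis dvd_mult)
qed

section \<open>The coordinate functional\<close>

lemma lookup_lin: "lookup (lin w f) i = (\<Sum>k\<in>keys f. lookup (w k) i)"
  by (simp add: lin_def lookup_sum)

lemma keys_lin_subset: "keys (lin w f) \<subseteq> (\<Union>k\<in>keys f. keys (w k))"
proof -
  have "lookup (lin w f) i = 0" if "i \<notin> (\<Union>k\<in>keys f. keys (w k))" for i
    unfolding lookup_lin using that by (intro sum.neutral) (auto simp: in_keys_iff)
  then show ?thesis unfolding in_keys_iff[symmetric] by blast
qed

lemma lin_shift_lookup:
  assumes "\<And>k. lookup (w (k + p)) i = lookup (w k) i"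
  shows "lookup (lin w (T p * f)) i = lookup (lin w f) i"
proof (induction f rule: f2_induct)
  case (add k f)
  then show ?case using assms[of k]
    by (simp add: distrib_left lin_add lookup_add mult_single add.commute del: add_bit_eq_xor)
qed simp

text \<open>A coordinate of period \<open>p\<close> vanishes on the multiples of
  \<open>T p + 1\<close>, so it factors through the quotient ring.\<close>

lemma lin_cg_lookup:
  assumes "\<And>k. lookup (w (k + p)) i = lookup (w k) i" and "cg p f g"
  shows "lookup (lin w f) i = lookup (lin w g) i"
proof -
  obtain q where "f + g = (T p + 1) * q" using assms(2) by (auto simp: cg_def dvd_def)
  then have "f = g + (T p * q + q)" by (metis add.commute f2_add_cancel_left distrib_right mult_1)
  then have "lin w f = lin w g + (lin w (T p * q) + lin w q)" by (simp add: lin_add)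
  then show ?thesis
    using lin_shift_lookup[of w p i q] assms(1) by (simp add: lookup_add del: add_bit_eq_xor)
qed

text \<open>Long division from the top: each round cancels the term of degree
  \<open>b + int N\<close> by a shift of \<open>f\<close>, whose leading coefficient can only be 1.
  As monomials are units, the remainder can be steered into any window of
  \<open>\<beta> - \<alpha>\<close> exponents that starts at or below the support of
  \<open>p\<close>.\<close>

lemma division_step:
  fixes f p :: "int \<Rightarrow>\<^sub>0 bit"
  assumes f: "keys f \<subseteq> {\<alpha>..\<beta>}" "\<beta> \<in> keys f"
    and p: "keys p \<subseteq> {b - (\<beta> - \<alpha>)..<b + int N}"
  shows "\<exists>q r. p = q * f + r \<and> keys r \<subseteq> {b - (\<beta> - \<alpha>)..<b}"
  using p
proof (induction N arbitrary: p)
  case 0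
  then show ?case by (intro exI[of _ 0] exI[of _ p]) simp
next
  case (Suc N)
  let ?k = "b + int N"
  show ?case
  proof (cases "?k \<in> keys p")
    case False
    then have "x \<in> {b - (\<beta> - \<alpha>)..<b + int N}" if "x \<in> keys p" for x
      using Suc.prems that by (cases "x = ?k") auto
    then have "keys p \<subseteq> {b - (\<beta> - \<alpha>)..<b + int N}" by blast
    then show ?thesis by (rule Suc.IH)
  next
    case True
    let ?s = "T (?k - \<beta>) * f"
    have ks: "keys ?s \<subseteq> {?k - \<beta> + \<alpha>..?k}" "?k \<in> keys ?s"
      using f by (auto simp: keys_T_mult image_iff intro!: bexI[of _ \<beta>])
    have "keys (p + ?s) \<subseteq> {b - (\<beta> - \<alpha>)..<b + int N}"
    proof
      fix x assume x: "x \<in> keys (p + ?s)"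
      then have "x \<noteq> ?k" using True ks(2) by (auto simp: keys_add_f2)
      moreover have "x \<in> keys p \<or> x \<in> keys ?s" using x by (auto simp: keys_add_f2)
      ultimately show "x \<in> {b - (\<beta> - \<alpha>)..<b + int N}" using ks(1) Suc.prems by force
    qed
    from Suc.IH[OF this] obtain q r where qr: "p + ?s = q * f + r" "keys r \<subseteq> {b - (\<beta> - \<alpha>)..<b}"
      by blast
    have "p = (p + ?s) + ?s" by (simp add: add.assoc)
    also have "\<dots> = (q + T (?k - \<beta>)) * f + r" unfolding qr(1) by (simp only: distrib_right distrib_left ac_simps)
    finally show ?thesis using qr(2) by blast
  qed
qed

text \<open>The top term of \<open>f\<close>, moved up by \<open>p\<close>, meets no other term and
  becomes the top of the product.\<close>

lemma keys_mult_T_plus_1: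
  fixes f :: "int \<Rightarrow>\<^sub>0 bit"
  assumes "f \<noteq> 0" "keys f \<subseteq> {\<alpha>..\<beta>}" "p > 0"
  obtains \<beta>' where "\<beta>' \<in> keys (f * (T p + 1))" "\<beta>' \<le> \<beta> + p"
    "keys (f * (T p + 1)) \<subseteq> {\<alpha>..\<beta>'}"
proof -
  have eq: "f * (T p + 1) = T p * f + f" by (simp add: algebra_simps)
  have fin: "finite (keys f)" "keys f \<noteq> {}" using assms(1) keys_f2_inject[of f 0] by auto
  define u where "u = Max (keys f)"
  have u: "u \<in> keys f" "\<And>x. x \<in> keys f \<Longrightarrow> x \<le> u" using fin by (auto simp: u_def)
  have "u + p \<notin> keys f" using u(2)[of "u + p"] assms(3) by auto
  then have "u + p \<in> keys (f * (T p + 1))"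
    unfolding eq keys_add_f2 keys_T_mult using u(1) by auto
  moreover have "u + p \<le> \<beta> + p" using u(1) assms(2) by auto
  moreover have "keys (f * (T p + 1)) \<subseteq> {\<alpha>..u + p}"
    unfolding eq keys_add_f2 keys_T_mult using u(2) assms(2,3) by fastforce
  ultimately show ?thesis by (rule that)
qed

lemma pow2_dvd_abs_less: "(2::int) ^ a dvd x \<Longrightarrow> \<bar>x\<bar> < 2 ^ a \<Longrightarrow> x = 0"
  by (metis abs_ge_zero abs_of_nonneg dvd_imp_le_int linorder_not_less abs_numeral power_abs)

locale scale =
  fixes \<nu> \<mu> :: "nat \<Rightarrow> nat"
  assumes nu_mono: "strict_mono \<nu>"
    and mu_nu: "\<nu> i + 2 \<le> \<mu> i"
    and mu_Suc: "\<mu> i + 6 \<le> \<mu> (Suc i)"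
begin

lemma mu_mono: "i < j \<Longrightarrow> \<mu> i + 6 \<le> \<mu> j"
proof (induction j)
  case (Suc j)
  then show ?case using mu_Suc[of i] mu_Suc[of j] by (cases "i = j") auto
qed simp

lemma nu_pow_mu: "4 * 2 ^ \<nu> i \<le> (2::int) ^ \<mu> i"
  using power_increasing[OF mu_nu[of i], of "2::int"] by (simp add: power_add)

lemma mu_not_dvd_nu: "\<not> (2::int) ^ \<mu> i dvd 2 ^ \<nu> i"
  using nu_pow_mu[of i] zdvd_imp_le[of "2 ^ \<mu> i" "2 ^ \<nu> i"] by (smt (verit) zero_less_power)

lemma nu_pow_le: "i \<le> j \<Longrightarrow> (2::int) ^ \<nu> i \<le> 2 ^ \<nu> j"
  using strict_mono_less_eq[OF nu_mono] by simp

lemma less_nu_pow: "int i < 2 ^ \<nu> i"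
proof -
  have "i \<le> \<nu> i" using nu_mono by (rule strict_mono_imp_increasing)
  then have "i < 2 ^ \<nu> i" using less_exp[of "\<nu> i"] by linarith
  then show ?thesis by (metis of_nat_less_iff of_nat_numeral of_nat_power)
qed

text \<open>Since n_i is at most a quarter of the modulus, it is the element of its residue class of
  smallest absolute value.\<close>

lemma res_bound: "(2::int) ^ \<mu> i dvd k - 2 ^ \<nu> i \<Longrightarrow> 2 ^ \<nu> i \<le> \<bar>k\<bar>"
proof (rule ccontr)
  assume d: "(2::int) ^ \<mu> i dvd k - 2 ^ \<nu> i" and n: "\<not> 2 ^ \<nu> i \<le> \<bar>k\<bar>"
  then have "\<bar>k - 2 ^ \<nu> i\<bar> < 2 ^ \<mu> i" using nu_pow_mu[of i] by linarith
  then have "k = 2 ^ \<nu> i" using pow2_dvd_abs_less[OF d] by simp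
  then show False using n by simp
qed

text \<open>Only the residue +n_i is recorded; -n_i enters through the symmetrization
  \<open>phi\<close>. The support is finite because \<open>res_bound\<close> and
  \<open>less_nu_pow\<close> leave only indices below |k|.\<close>

definition wt :: "int \<Rightarrow> nat \<Rightarrow>\<^sub>0 bit"
  where "wt k = Abs_poly_mapping (\<lambda>i. if 2 ^ \<mu> i dvd k - 2 ^ \<nu> i then 1 else 0)"

lemma lookup_wt: "lookup (wt k) i = (if 2 ^ \<mu> i dvd k - 2 ^ \<nu> i then 1 else 0)"
proof -
  have "{i. (if 2 ^ \<mu> i dvd k - 2 ^ \<nu> i then 1 else (0::bit)) \<noteq> 0} \<subseteq> {i. int i < \<bar>k\<bar>}"
    using less_le_trans[OF less_nu_pow res_bound] by (auto split: if_splits)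
  moreover have "{i. int i < \<bar>k\<bar>} \<subseteq> {..nat \<bar>k\<bar>}" by auto
  ultimately have "finite {i. (if 2 ^ \<mu> i dvd k - 2 ^ \<nu> i then 1 else (0::bit)) \<noteq> 0}"
    by (meson finite_atMost finite_subset)
  then show ?thesis by (simp add: wt_def)
qed

lemma keys_wt: "i \<in> keys (wt k) \<longleftrightarrow> 2 ^ \<mu> i dvd k - 2 ^ \<nu> i"
  by (simp add: in_keys_iff lookup_wt)

definition lam :: "(int \<Rightarrow>\<^sub>0 bit) \<Rightarrow> nat \<Rightarrow>\<^sub>0 bit"
  where "lam = lin wt"

lemma lam_0 [simp]: "lam 0 = 0" and lam_add: "lam (f + g) = lam f + lam g" and lam_T: "lam (T k) = wt k"
  by (simp_all add: lam_def lin_add)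

lemma keys_lam: "i \<in> keys (lam f) \<Longrightarrow> \<exists>k\<in>keys f. 2 ^ \<mu> i dvd k - 2 ^ \<nu> i"
  using keys_lin_subset[of wt f] keys_wt unfolding lam_def by blast

lemma lam_bound:
  assumes "\<And>k. k \<in> keys f \<Longrightarrow> \<bar>k\<bar> \<le> b" "i \<in> keys (lam f)"
  shows "2 ^ \<nu> i \<le> b"
  using keys_lam[OF assms(2)] assms(1) res_bound by (meson order_trans)

lemma lam_cg: "cg p f g \<Longrightarrow> 2 ^ \<mu> i dvd p \<Longrightarrow> lookup (lam f) i = lookup (lam g) i"
  (is "_ \<Longrightarrow> _ \<Longrightarrow> ?thesis")
proof -
  assume "cg p f g" and p: "2 ^ \<mu> i dvd p"
  have "lookup (wt (k + p)) i = lookup (wt k) i" for k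
    using dvd_add_left_iff[OF p, of "k - 2 ^ \<nu> i"] by (simp add: lookup_wt algebra_simps)
  then show ?thesis using \<open>cg p f g\<close> unfolding lam_def by (rule lin_cg_lookup)
qed

text \<open>The commutator form: lamp configurations \<open>p\<close> and \<open>f\<close> commute
  up to the central element \<open>phi (star p * f)\<close>, see
  \<open>mul_commute_base\<close>.\<close>

definition phi :: "(int \<Rightarrow>\<^sub>0 bit) \<Rightarrow> nat \<Rightarrow>\<^sub>0 bit"
  where "phi f = lam f + lam (star f)"

lemma phi_add: "phi (f + g) = phi f + phi g"
  by (simp add: phi_def lam_add star_add algebra_simps)

lemma phi_0 [simp]: "phi 0 = 0"
  by (simp add: phi_def)

lemma star_cg: "cg p f g \<Longrightarrow> cg p (star f) (star g)"
proof -
  assume "cg p f g"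
  then obtain q where "f + g = (T p + 1) * q" by (auto simp: cg_def dvd_def)
  then have "star f + star g = (T (- p) + 1) * star q" by (metis star_add star_mult star_T star_1)
  moreover have "T p + 1 dvd T (- p) + 1" by (rule T_plus_1_dvd) simp
  ultimately show ?thesis by (simp add: cg_def)
qed

lemma phi_cg: "cg p f g \<Longrightarrow> 2 ^ \<mu> i dvd p \<Longrightarrow> lookup (phi f) i = lookup (phi g) i"
  unfolding phi_def lookup_add using lam_cg star_cg by metis

text \<open>Either m_i divides n_j and would then divide the smaller n_i, or both powers lie below
  m_i and congruence is equality.\<close>

lemma res_pow:
  assumes "(2::int) ^ \<mu> i dvd 2 ^ \<nu> j - 2 ^ \<nu> i" shows "i = j"
proof (rule ccontr)
  assume ne: "i \<noteq> j"
  have "2 ^ \<nu> i \<le> (2::int) ^ \<nu> j" using res_bound[OF assms] by simp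
  then have "\<nu> i < \<nu> j" using ne strict_mono_eq[OF nu_mono, of i j] by (simp add: le_neq_implies_less)
  show False
  proof (cases "\<mu> i \<le> \<nu> j")
    case True
    then have "(2::int) ^ \<mu> i dvd 2 ^ \<nu> j" by (rule le_imp_power_dvd)
    then have "(2::int) ^ \<mu> i dvd 2 ^ \<nu> i" using assms by (metis dvd_diff_right_iff)
    then show False using mu_not_dvd_nu by blast
  next
    case False
    then have "(2::int) ^ \<nu> j < 2 ^ \<mu> i" by simp
    then have "\<bar>2 ^ \<nu> j - (2::int) ^ \<nu> i\<bar> < 2 ^ \<mu> i" using \<open>2 ^ \<nu> i \<le> (2::int) ^ \<nu> j\<close> by (smt (verit) zero_less_power)
    from pow2_dvd_abs_less[OF assms this] show False using \<open>\<nu> i < \<nu> j\<close> by simp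
  qed
qed

text \<open>As in \<open>res_pow\<close>; in the second case n_j \<le> m_i / 2 and n_i \<le> m_i / 4
  keep their sum strictly between 0 and m_i.\<close>

lemma res_neg_pow: "\<not> (2::int) ^ \<mu> i dvd - (2 ^ \<nu> j) - 2 ^ \<nu> i"
proof
  assume d: "(2::int) ^ \<mu> i dvd - (2 ^ \<nu> j) - 2 ^ \<nu> i"
  show False
  proof (cases "\<mu> i \<le> \<nu> j")
    case True
    then have "(2::int) ^ \<mu> i dvd - (2 ^ \<nu> j)" by (simp add: le_imp_power_dvd)
    then have "(2::int) ^ \<mu> i dvd 2 ^ \<nu> i" using d by (metis dvd_diff_right_iff)
    then show False using mu_not_dvd_nu by blast
  next
    case False
    then have "2 * (2::int) ^ \<nu> j \<le> 2 ^ \<mu> i" using power_increasing[of "Suc (\<nu> j)" "\<mu> i" "2::int"] by simp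
    moreover have "(0::int) < 2 ^ \<nu> j" "(0::int) < 2 ^ \<nu> i" by simp_all
    ultimately have "\<bar>- (2 ^ \<nu> j) - 2 ^ \<nu> i\<bar> < (2::int) ^ \<mu> i" using nu_pow_mu[of i] by linarith
    from pow2_dvd_abs_less[OF d this] show False using \<open>(0::int) < 2 ^ \<nu> j\<close> \<open>(0::int) < 2 ^ \<nu> i\<close> by linarith
  qed
qed

lemma wt_pow: "wt (2 ^ \<nu> j) = Poly_Mapping.single j 1"
proof (rule poly_mapping_eqI)
  fix i show "lookup (wt (2 ^ \<nu> j)) i = lookup (Poly_Mapping.single j 1) i"
    using res_pow[of i j] by (cases "i = j") (auto simp: lookup_wt lookup_single)
qed

lemma wt_neg_pow: "wt (- (2 ^ \<nu> j)) = 0"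
  by (rule poly_mapping_eqI) (simp add: lookup_wt res_neg_pow)

text \<open>This exhibits e_j as the commutator of the lamps at 0 and n_j.\<close>

lemma phi_pow: "phi (T (2 ^ \<nu> j)) = Poly_Mapping.single j 1"
  by (simp add: phi_def lam_T wt_pow wt_neg_pow)

text \<open>The interval between two consecutive powers of two contains no \<open>2^\<nu>(i)\<close>.\<close>
lemma phi_gap:
  assumes "\<And>k. k \<in> keys f \<Longrightarrow> 2 ^ \<mu> j < 4 * \<bar>k\<bar> \<and> 2 * \<bar>k\<bar> < 2 ^ \<mu> j" and "j \<le> i"
  shows "i \<notin> keys (phi f)"
proof -
  have "\<not> 2 ^ \<mu> i dvd k - 2 ^ \<nu> i" if k: "(2::int) ^ \<mu> j < 4 * \<bar>k\<bar>" "2 * \<bar>k\<bar> < 2 ^ \<mu> j" for k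
  proof
    assume d: "2 ^ \<mu> i dvd k - 2 ^ \<nu> i"
    have "\<mu> j \<le> \<mu> i" using mu_mono[of j i] assms(2) by (cases "i = j") auto
    then have "(2::int) ^ \<mu> j \<le> 2 ^ \<mu> i" by simp
    then have "\<bar>k - 2 ^ \<nu> i\<bar> < 2 ^ \<mu> i" using k(2) nu_pow_mu[of i] by (smt (verit) zero_less_power)
    from pow2_dvd_abs_less[OF d this] have "k = 2 ^ \<nu> i" by simp
    \<comment> \<open>The exponent \<open>\<nu> i\<close> would have to lie strictly between
      \<open>\<mu> j - 2\<close> and \<open>\<mu> j - 1\<close>.\<close>
    then have "(2::int) ^ \<mu> j < 2 ^ (\<nu> i + 2)" "(2::int) ^ (\<nu> i + 1) < 2 ^ \<mu> j" using k by (simp_all add: power_add)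
    then have "\<mu> j < \<nu> i + 2" "\<nu> i + 1 < \<mu> j" by (simp_all only: power_strict_increasing_iff one_less_numeral_iff semiring_norm)
    then show False by simp
  qed
  then have "i \<notin> keys (lam f)" "i \<notin> keys (lam (star f))"
    using keys_lam[of i f] keys_lam[of i "star f"] assms(1) by (auto simp: keys_star)
  then show ?thesis by (simp add: phi_def keys_add_f2)
qed

text \<open>Dividing \<open>t^(2^\<nu>(j))\<close> by \<open>f (t^p - 1)\<close> with a remainder supported in a gap isolates the
  \<open>j\<close>-th coordinate: the coordinates below \<open>j\<close> have period \<open>p\<close>, the others do not see the gap.\<close>
lemma single_in_phi_ideal_aux:
  assumes f: "f \<noteq> 0" "keys f \<subseteq> {\<alpha>..\<beta>}" and p: "p > 0" "\<And>i. i < j \<Longrightarrow> 2 ^ \<mu> i dvd p"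
    and small: "4 * (\<beta> - \<alpha> + p + 1) \<le> 2 ^ \<mu> j"
  shows "\<exists>q. phi (q * f) = Poly_Mapping.single j 1"
proof -
  let ?f = "f * (T p + 1)" and ?m = "(2::int) ^ (\<mu> j - 2)"
  have m: "(2::int) ^ \<mu> j = 4 * ?m"
  proof -
    have "\<mu> j = 2 + (\<mu> j - 2)" using mu_nu[of j] by simp
    then have "(2::int) ^ \<mu> j = 2 ^ 2 * ?m" by (metis power_add)
    then show ?thesis by simp
  qed
  obtain \<beta>' where b: "\<beta>' \<in> keys ?f" "\<beta>' \<le> \<beta> + p" "keys ?f \<subseteq> {\<alpha>..\<beta>'}"
    by (rule keys_mult_T_plus_1[OF f p(1)])
  have w: "0 \<le> \<beta>' - \<alpha>" using b by auto
  \<comment> \<open>The remainder window starts at -m_j / 2 + 1, and by \<open>small\<close> it ends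
    before -m_j / 4: it lies in the gap of \<open>phi_gap\<close>.\<close>
  define b0 where "b0 = - 2 * ?m + 1 + (\<beta>' - \<alpha>)"
  define n :: int where "n = 2 ^ \<nu> j"
  have n: "n > 0" by (simp add: n_def)
  have "b0 \<le> - ?m" using b(2) small by (simp add: b0_def m)
  have "keys (T n) \<subseteq> {b0 - (\<beta>' - \<alpha>)..<b0 + int (nat (n - b0 + 1))}"
    using n w \<open>b0 \<le> - ?m\<close> by (simp add: b0_def)
  from division_step[OF b(3,1) this] obtain q r
    where qr: "T n = q * ?f + r" "keys r \<subseteq> {b0 - (\<beta>' - \<alpha>)..<b0}" by blast
  have r: "2 ^ \<mu> j < 4 * \<bar>k\<bar> \<and> 2 * \<bar>k\<bar> < 2 ^ \<mu> j" if "k \<in> keys r" for k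
  proof -
    have "- 2 * ?m < k" "k < - ?m" using qr(2) that \<open>b0 \<le> - ?m\<close> by (auto simp: b0_def)
    then show ?thesis unfolding m by auto
  qed
  have "phi (q * ?f) = Poly_Mapping.single j 1"
  proof (rule poly_mapping_eqI)
    fix i
    show "lookup (phi (q * ?f)) i = lookup (Poly_Mapping.single j 1) i"
    proof (cases "i < j")
      case True
      have "cg p (q * ?f) 0" by (simp add: cg_def)
      then have "lookup (phi (q * ?f)) i = lookup (phi 0) i" using p(2)[OF True] by (rule phi_cg)
      then show ?thesis using True by (simp add: lookup_single)
    next
      case False
      have "q * ?f = T n + r" by (simp add: qr(1) add.assoc)
      then have "phi (q * ?f) = Poly_Mapping.single j 1 + phi r" by (simp add: phi_add n_def phi_pow)
      moreover have "lookup (phi r) i = 0" using phi_gap[OF r, where i=i] False by (simp add: in_keys_iff)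
      ultimately show ?thesis by (simp add: lookup_add)
    qed
  qed
  then show ?thesis by (metis mult.assoc mult.commute)
qed

text \<open>The period \<open>p\<close> is taken as m_(j-1), a common multiple of all smaller
  moduli, or as 1 when there are none.\<close>

lemma single_in_phi_ideal:
  assumes f: "f \<noteq> 0" "keys f \<subseteq> {\<alpha>..\<beta>}" and small: "16 * (\<beta> - \<alpha> + 1) \<le> 2 ^ \<mu> j"
  shows "\<exists>q. phi (q * f) = Poly_Mapping.single j 1"
proof (cases j)
  case 0
  have "\<alpha> \<le> \<beta>" using f keys_f2_inject[of f 0] by fastforce
  then show ?thesis using 0 small by (intro single_in_phi_ideal_aux[OF f, where p=1]) auto
next
  case (Suc i)
  have le: "\<mu> h \<le> \<mu> i" if "h < j" for h using that mu_mono[of h i] Suc by (cases "h = i") auto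
  \<comment> \<open>The growth factor 64 pays for the period: in the inequality with 5 below, the
    width accounts for 4 m_j and the period for m_j.\<close>
  have "64 * (2::int) ^ \<mu> i \<le> 2 ^ \<mu> j"
    using power_increasing[OF mu_Suc[of i], of "2::int"] Suc by (simp add: power_add)
  then have "16 * (4 * (\<beta> - \<alpha> + 2 ^ \<mu> i + 1)) \<le> 5 * 2 ^ \<mu> j" using small by simp
  moreover have "(0::int) < 2 ^ \<mu> j" by simp
  ultimately have "4 * (\<beta> - \<alpha> + 2 ^ \<mu> i + 1) \<le> 2 ^ \<mu> j" by linarith
  then show ?thesis using le
    by (intro single_in_phi_ideal_aux[OF f, where p="2 ^ \<mu> i"]) (auto simp: le_imp_power_dvd)
qed

text \<open>Coordinates are hit one at a time and the multipliers added. Later this lets the lamps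
  of a conjugator absorb any central defect supported on large moduli.\<close>

lemma phi_ideal_surj:
  assumes f: "f \<noteq> 0" "keys f \<subseteq> {\<alpha>..\<beta>}"
    and small: "\<And>i. i \<in> keys y \<Longrightarrow> 16 * (\<beta> - \<alpha> + 1) \<le> 2 ^ \<mu> i"
  shows "\<exists>q. phi (q * f) = y"
  using small
proof (induction y rule: f2_induct)
  case zero
  then show ?case by (intro exI[of _ 0]) simp
next
  case (add k y)
  have "keys (Poly_Mapping.single k 1 + y) = insert k (keys y)" using add.hyps by (auto simp: keys_add_f2)
  then obtain q q' where "phi (q * f) = y" "phi (q' * f) = Poly_Mapping.single k 1"
    using add single_in_phi_ideal[OF f, of k] by auto
  then have "phi ((q' + q) * f) = Poly_Mapping.single k 1 + y" by (simp add: distrib_right phi_add)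
  then show ?case by blast
qed

end

section \<open>Reduction modulo \<open>t^M - 1\<close>\<close>

lemma cg_eq_fold:
  fixes M :: int
  shows "cg M f (lin (\<lambda>k. T (k mod M)) f)"
proof (induction f rule: f2_induct)
  case (add k f)
  have "cg M (T k) (T (k mod M))" by (rule cg_T) simp
  then show ?case using add by (simp add: lin_add cg_add)
qed simp

text \<open>Reducing exponents is a normal form for \<open>cg M\<close>, so finite quotients can be
  described by values instead of classes.\<close>

lemma fold_eq_iff:
  fixes M :: int
  shows "lin (\<lambda>k. T (k mod M)) f = lin (\<lambda>k. T (k mod M)) g \<longleftrightarrow> cg M f g"
proof
  assume "cg M f g"
  then show "lin (\<lambda>k. T (k mod M)) f = lin (\<lambda>k. T (k mod M)) g"
    by (intro poly_mapping_eqI lin_cg_lookup[where p = M]) simp_all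
next
  assume "lin (\<lambda>k. T (k mod M)) f = lin (\<lambda>k. T (k mod M)) g"
  then show "cg M f g" by (metis cg_eq_fold cg_sym cg_trans)
qed

lemma keys_fold: "M > 0 \<Longrightarrow> keys (lin (\<lambda>k. T (k mod M)) f) \<subseteq> {0..<M}"
  using keys_lin_subset[of "\<lambda>k. T (k mod M)" f] by auto

lemma keys_fold_inj:
  fixes M :: int
  assumes "inj_on (\<lambda>k. k mod M) (keys f)" "x \<in> keys f"
  shows "x mod M \<in> keys (lin (\<lambda>k. T (k mod M)) f)"
proof -
  have "lookup (lin (\<lambda>k. T (k mod M)) f) (x mod M) = (\<Sum>k\<in>keys f. if k = x then 1 else 0)"
    unfolding lookup_lin using assms by (intro sum.cong) (auto simp: lookup_single when_def inj_on_def)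
  then show ?thesis using assms(2) by (simp add: in_keys_iff)
qed

lemma inj_on_mod_interval: "b - a < M \<Longrightarrow> inj_on (\<lambda>k. k mod M) {a..(b::int)}"
proof (rule inj_onI)
  fix x y :: int
  assume *: "b - a < M" "x \<in> {a..b}" "y \<in> {a..b}" "x mod M = y mod M"
  then have "M dvd x - y" by (simp add: mod_eq_dvd_iff)
  then show "x = y" using * zdvd_imp_le[of M "x - y"] zdvd_imp_le[of M "y - x"] dvd_diff_commute[of M x y] by force
qed

text \<open>On a window shorter than \<open>M\<close> reduction of exponents is injective, so no
  terms of the difference can cancel.\<close>

lemma cg_small_eq:
  assumes "cg M f g" "keys f \<subseteq> {a..b}" "keys g \<subseteq> {a..b}" "b - a < M"
  shows "f = g"
proof (rule ccontr)
  assume "f \<noteq> g"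
  then have "keys (f + g) \<noteq> {}" using keys_f2_inject[of "f + g" 0] by simp
  then obtain x where x: "x \<in> keys (f + g)" by blast
  have "keys (f + g) \<subseteq> {a..b}" using assms(2,3) by (auto simp: keys_add_f2)
  then have "inj_on (\<lambda>k. k mod M) (keys (f + g))" using inj_on_mod_interval[OF assms(4)] inj_on_subset by blast
  from keys_fold_inj[OF this x] have "lin (\<lambda>k. T (k mod M)) (f + g) \<noteq> lin (\<lambda>k. T (k mod M)) 0" by auto
  moreover have "cg M (f + g) 0" using assms(1) by (simp add: cg_def)
  ultimately show False using fold_eq_iff by blast
qed

text \<open>The factor \<open>T k + 1\<close> moves one extreme term of \<open>q\<close> outwards
  and leaves the opposite extreme in place; neither meets another term.\<close>

lemma keys_factor:
  assumes "keys ((T k + 1) * q) \<subseteq> {a..b}" "k \<noteq> 0"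
  shows "keys q \<subseteq> {a..b}"
proof (cases "q = 0")
  case False
  have eq: "keys ((T k + 1) * q) = ((+) k ` keys q - keys q) \<union> (keys q - (+) k ` keys q)"
    by (simp add: distrib_right keys_add_f2 keys_T_mult)
  have ne: "finite (keys q)" "keys q \<noteq> {}" using False keys_f2_inject[of q 0] by auto
  define u l where "u = Max (keys q)" and "l = Min (keys q)"
  have u: "u \<in> keys q" "\<And>x. x \<in> keys q \<Longrightarrow> x \<le> u" and l: "l \<in> keys q" "\<And>x. x \<in> keys q \<Longrightarrow> l \<le> x"
    using ne by (auto simp: u_def l_def)
  have "u \<le> b \<and> a \<le> l"
  proof (cases "k > 0")
    case True
    then have "k + u \<notin> keys q" "l \<notin> (+) k ` keys q" using u(2) l(2) by force+
    then have "k + u \<in> {a..b}" "l \<in> {a..b}" using u(1) l(1) assms(1) unfolding eq by auto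
    then show ?thesis using True by auto
  next
    case False
    then have "k < 0" using assms(2) by simp
    then have "k + l \<notin> keys q" "u \<notin> (+) k ` keys q" using u(2) l(2) by force+
    then have "k + l \<in> {a..b}" "u \<in> {a..b}" using u(1) l(1) assms(1) unfolding eq by auto
    then show ?thesis using \<open>k < 0\<close> by auto
  qed
  then show ?thesis using u(2) l(2) by force
qed simp

section \<open>Periods that are powers of two\<close>

lemma T_double: "T (2 * H) + 1 = (T H + 1) * (T H + 1)"
proof -
  have "(T H + 1) * (T H + 1) = T H * T H + (T H + T H) + 1"
    by (simp only: distrib_left distrib_right mult_1 mult_1_right add.assoc)
  then show ?thesis by (simp add: T_mult)
qed

lemma odd_part: "(k::int) \<noteq> 0 \<Longrightarrow> \<exists>v o'. k = 2 ^ v * o' \<and> odd o'"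
  using multiplicity_decompose'[of k 2] by (metis odd_one)

text \<open>Let M = \<open>2 ^ \<sigma>\<close> and H = M / 2. Some multiple of \<open>k\<close> is
  an odd multiple of H, hence congruent to H mod M, so \<open>T M + 1\<close> divides
  \<open>(T H + 1) * q\<close>. In characteristic 2 the divisor is the square of
  \<open>T H + 1\<close>, and one factor cancels.\<close>

lemma dvd_half:
  assumes "\<not> 2 ^ \<sigma> dvd k" "T (2 ^ \<sigma>) + 1 dvd (T k + 1) * q"
  shows "T (2 ^ (\<sigma> - 1)) + 1 dvd q"
proof -
  have "k \<noteq> 0" using assms(1) by auto
  then obtain v c where k: "k = 2 ^ v * c" "odd c" using odd_part by blast
  have v: "v < \<sigma>" using assms(1) k(1) by (meson dvd_triv_left le_imp_power_dvd not_less dvd_trans)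
  define H :: int where "H = 2 ^ (\<sigma> - 1)"
  have M: "2 ^ \<sigma> = 2 * H" using v by (cases \<sigma>) (auto simp: H_def)
  have "(2::int) ^ (\<sigma> - 1) = 2 ^ (v + (\<sigma> - 1 - v))" using v by simp
  then have "H = 2 ^ v * 2 ^ (\<sigma> - 1 - v)" unfolding H_def by (simp only: power_add)
  then have kH: "k * 2 ^ (\<sigma> - 1 - v) = H * c" by (simp add: k(1))
  have "T (2 * H) + 1 dvd (T (H * c) + 1) * q"
  proof -
    have "k dvd H * c" unfolding kH[symmetric] by simp
    then have "(T k + 1) * q dvd (T (H * c) + 1) * q" by (intro mult_dvd_mono T_plus_1_dvd) simp_all
    with assms(2) show ?thesis unfolding M by (rule dvd_trans)
  qed
  moreover have "2 * H dvd H * c - H"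
  proof -
    obtain e where "c = 2 * e + 1" using k(2) by (rule oddE)
    then show ?thesis by (simp add: algebra_simps)
  qed
  from cg_T[OF this] have "T (2 * H) + 1 dvd (T (H * c) + T H) * q" unfolding cg_def by (rule dvd_mult2)
  ultimately have "T (2 * H) + 1 dvd (T (H * c) + 1) * q + (T (H * c) + T H) * q" by (rule dvd_add)
  also have "(T (H * c) + 1) * q + (T (H * c) + T H) * q = (T H + 1) * q"
  proof -
    have "T (H * c) + 1 + (T (H * c) + T H) = T (H * c) + (T (H * c) + (T H + 1))" by (simp only: ac_simps)
    then show ?thesis unfolding distrib_right[symmetric] by simp
  qed
  finally have "(T H + 1) * (T H + 1) dvd (T H + 1) * q" by (simp only: T_double)
  moreover have "T H + 1 \<noteq> 0"
  proof
    assume "T H + 1 = 0"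
    then have "T H = T 0" by simp
    then have "keys (T H) = keys (T 0)" by (rule arg_cong)
    then show False by (simp add: H_def)
  qed
  ultimately show ?thesis unfolding H_def by (simp only: dvd_mult_cancel_left simp_thms)
qed

text \<open>The odd part \<open>c\<close> is invertible mod \<open>2 ^ \<sigma>\<close>. The
  solution is a natural number since it serves as an exponent in \<open>pw\<close>.\<close>

lemma solve_pow2:
  fixes s k :: int
  assumes "k = 2 ^ a * c" "odd c" "2 ^ a dvd s"
  shows "\<exists>u::nat. 2 ^ \<sigma> dvd s + int u * k"
proof -
  obtain s' where s: "s = 2 ^ a * s'" using assms(3) by (auto elim: dvdE)
  have "coprime c (2 ^ \<sigma>)" using assms(2) by (simp add: coprime_commute)
  then obtain e where e: "[c * e = 1] (mod 2 ^ \<sigma>)" using cong_solve_coprime_int by blast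
  define u where "u = nat ((- s' * e) mod 2 ^ \<sigma>)"
  have "[int u = - s' * e] (mod 2 ^ \<sigma>)" by (simp add: u_def cong_def)
  then have "[int u * c = - s' * e * c] (mod 2 ^ \<sigma>)" by (rule cong_scalar_right)
  also have "[- s' * e * c = - s' * 1] (mod 2 ^ \<sigma>)" using cong_scalar_left[OF e, of "- s'"] by (simp add: ac_simps)
  finally have "2 ^ \<sigma> dvd int u * c + s'" by (simp add: cong_iff_dvd_diff)
  then have "2 ^ \<sigma> dvd 2 ^ a * (int u * c + s')" by (rule dvd_mult)
  moreover have "2 ^ a * (int u * c + s') = s + int u * k"
    unfolding s assms(1) distrib_left by (simp only: ac_simps)
  ultimately have "2 ^ \<sigma> dvd s + int u * k" by (simp only:)
  then show ?thesis by blast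
qed

section \<open>The central extension\<close>

type_synonym el = "int \<times> (int \<Rightarrow>\<^sub>0 bit) \<times> (nat \<Rightarrow>\<^sub>0 bit)"

context scale
begin

text \<open>A central extension of the lamplighter group: \<open>(k, f, c)\<close> has shift \<open>k\<close>, lamps \<open>f\<close> and
  central part \<open>c\<close>.\<close>
fun mul :: "el \<Rightarrow> el \<Rightarrow> el"
  where "mul (k, f, c) (k', f', c') = (k + k', f + T k * f', c + c' + lam (star f * (T k * f')))"

abbreviation unit :: el
  where "unit \<equiv> (0, 0, 0)"

fun inv_el :: "el \<Rightarrow> el"
  where "inv_el (k, f, c) = (- k, T (- k) * f, c + lam (star f * f))"

text \<open>The cocycle \<open>lam (star f * g)\<close> is biadditive, and invariant under a common
  shift because \<open>star (T k) * T k = 1\<close>.\<close>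

lemma mul_assoc: "mul (mul x y) z = mul x (mul y z)"
proof (cases x; cases y; cases z)
  fix k1 f1 c1 k2 f2 c2 k3 f3 c3
  assume *: "x = (k1, f1, c1)" "y = (k2, f2, c2)" "z = (k3, f3, c3)"
  have "T (- k1) * star f2 * (T (k1 + k2) * f3) = star f2 * (T (- k1) * (T (k1 + k2) * f3))"
    by (simp only: ac_simps)
  then have "lam (star (T k1 * f2) * (T (k1 + k2) * f3)) = lam (star f2 * (T k2 * f3))"
    by (simp only: star_mult star_T T_mult_left) simp
  then show ?thesis
    by (simp add: * distrib_left distrib_right star_add lam_add T_mult_left)
qed

lemma mul_unit_left [simp]: "mul unit x = x" and mul_unit_right [simp]: "mul x unit = x"
  by (cases x; simp)+

lemma inv_el_left: "mul (inv_el x) x = unit"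
proof (cases x)
  case (fields k f c)
  have "T k * star f * (T (- k) * f) = star f * (T k * (T (- k) * f))" by (simp only: ac_simps)
  then have "lam (star (T (- k) * f) * (T (- k) * f)) = lam (star f * f)"
    by (simp only: star_mult star_T minus_minus T_mult_left) simp
  then show ?thesis by (simp add: fields)
qed

lemma mul_inv_el_left: "mul (inv_el x) (mul x y) = y"
  by (simp add: mul_assoc[symmetric] inv_el_left)

lemma inv_el_right: "mul x (inv_el x) = unit"
  by (cases x) (simp add: T_mult_left)

lemma central: "mul x (0, 0, z) = mul (0, 0, z) x"
  by (cases x) (simp add: add.commute)

lemma mul_commute_base:
  "mul (0, p, c) (0, f, d) = mul (mul (0, f, d) (0, p, c)) (0, 0, phi (star p * f))"
  by (simp add: phi_def lam_add star_mult mult.commute ac_simps)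

text \<open>The kernel congruence of the finite quotient in which the shift and the lamps are taken
  modulo \<open>M\<close> and only the central coordinates below \<open>J\<close> are kept.\<close>
fun eqv :: "int \<Rightarrow> nat \<Rightarrow> el \<Rightarrow> el \<Rightarrow> bool"
  where "eqv M J (k, f, c) (k', f', c') \<longleftrightarrow>
    M dvd k - k' \<and> cg M f f' \<and> (\<forall>i<J. lookup c i = lookup c' i)"

lemma eqv_refl [simp]: "eqv M J x x"
  by (cases x) simp

lemma eqv_sym: "eqv M J x y \<Longrightarrow> eqv M J y x"
  by (cases x; cases y) (auto simp: dvd_diff_commute intro: cg_sym)

text \<open>The cocycle is read only in coordinates whose modulus divides \<open>M\<close>, where it
  depends on the lamps mod \<open>T M + 1\<close> alone.\<close>

lemma eqv_mul:
  assumes M: "\<And>i. i < J \<Longrightarrow> 2 ^ \<mu> i dvd M" and "eqv M J x x'" "eqv M J y y'"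
  shows "eqv M J (mul x y) (mul x' y')"
proof (cases x; cases y; cases x'; cases y')
  fix k f c k' f' c' l g d l' g' d'
  assume *: "x = (k, f, c)" "x' = (k', f', c')" "y = (l, g, d)" "y' = (l', g', d')"
  have h: "M dvd k - k'" "cg M f f'" "\<And>i. i < J \<Longrightarrow> lookup c i = lookup c' i"
    "M dvd l - l'" "cg M g g'" "\<And>i. i < J \<Longrightarrow> lookup d i = lookup d' i"
    using assms * by auto
  have "M dvd (k - k') + (l - l')" using h by (intro dvd_add)
  then have 1: "M dvd (k + l) - (k' + l')" by (simp add: algebra_simps)
  have 2: "cg M (T k * g) (T k' * g')" using h by (intro cg_mult cg_T)
  have "cg M (star f * (T k * g)) (star f' * (T k' * g'))" using cg_mult[OF star_cg[OF h(2)] 2] .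
  then have "lookup (lam (star f * (T k * g))) i = lookup (lam (star f' * (T k' * g'))) i" if "i < J" for i
    using lam_cg M that by blast
  then show ?thesis using 1 2 h by (auto simp: * lookup_add intro: cg_add simp del: add_bit_eq_xor)
qed

lemma eqv_mul_left_cancel:
  assumes M: "\<And>i. i < J \<Longrightarrow> 2 ^ \<mu> i dvd M" and "eqv M J (mul x y) (mul x z)"
  shows "eqv M J y z"
  using eqv_mul[OF M eqv_refl[of M J "inv_el x"] assms(2)] by (simp add: mul_inv_el_left)

fun pw :: "el \<Rightarrow> nat \<Rightarrow> el"
  where "pw x 0 = unit" | "pw x (Suc u) = mul x (pw x u)"

lemma pw_commute: "mul (pw x u) x = mul x (pw x u)"
  by (induction u) (simp_all add: mul_assoc)

lemma fst_mul: "fst (mul x y) = fst x + fst y"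
  by (cases x; cases y) simp

lemma fst_pw: "fst (pw x u) = int u * fst x"
  by (induction u) (simp_all add: fst_mul algebra_simps)

text \<open>In the quotient \<open>h\<close> has only lamps \<open>q\<close> and a central part, and
  commuting with a shift by \<open>k\<close> says that \<open>T k + 1\<close> kills
  \<open>q\<close>. By \<open>dvd_half\<close>, \<open>q\<close> vanishes modulo half the period.
  The spare factor 2 in assumption \<open>M\<close> makes this still a multiple of m_i, so both
  cocycle terms drop out.\<close>

lemma commutator_shift_0:
  assumes M: "\<And>i. i < J \<Longrightarrow> 2 * 2 ^ \<mu> i dvd (2::int) ^ \<sigma>"
    and e: "eqv (2 ^ \<sigma>) J (mul h g) (mul (mul g h) (0, 0, z))"
    and h: "2 ^ \<sigma> dvd fst h" and g: "\<not> 2 ^ \<sigma> dvd fst g" and i: "i < J"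
  shows "lookup z i = 0"
proof -
  obtain s q d k f c where hg: "h = (s, q, d)" "g = (k, f, c)" by (cases h; cases g) auto
  let ?M = "(2::int) ^ \<sigma>" and ?H = "(2::int) ^ (\<sigma> - 1)"
  have cs: "cg ?M (T s) (T 0)" using h by (intro cg_T) (simp add: hg)
  have "cg ?M (q + T s * f) (f + T k * q)"
    using e by (simp add: hg)
  moreover have "cg ?M (T s * f) f" using cg_mult[OF cs, of f f] by simp
  ultimately have "cg ?M (q + T s * f + T s * f) (f + T k * q + f)" by (rule cg_add)
  then have "T ?M + 1 dvd (T k + 1) * q"
    by (simp add: cg_def algebra_simps)
  then have "T ?H + 1 dvd q" using g hg by (intro dvd_half[where k = k]) auto
  then have q: "cg ?H q 0" by (simp add: cg_def)
  have Hi: "2 ^ \<mu> i dvd ?H"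
  proof -
    have "(2::int) ^ Suc (\<mu> i) dvd 2 ^ \<sigma>" using M[OF i] by simp
    then have "(2::int) ^ Suc (\<mu> i) \<le> 2 ^ \<sigma>" by (rule zdvd_imp_le) simp
    then have "Suc (\<mu> i) \<le> \<sigma>" by (rule power_le_imp_le_exp[rotated]) simp
    then show ?thesis by (intro le_imp_power_dvd) simp
  qed
  have "cg ?H (star q * (T s * f)) (star 0 * (T s * f))" using q by (intro cg_mult star_cg) simp_all
  then have l1: "lookup (lam (star q * (T s * f))) i = 0" using lam_cg[OF _ Hi] by fastforce
  have "cg ?H (star f * (T k * q)) (star f * (T k * 0))" using q by (intro cg_mult) simp_all
  then have l2: "lookup (lam (star f * (T k * q))) i = 0" using lam_cg[OF _ Hi] by fastforce
  have "lookup (d + c + lam (star q * (T s * f))) i = lookup (c + d + lam (star f * (T k * q)) + z) i"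
    using e i by (simp add: hg)
  then show ?thesis using l1 l2
    by (simp add: lookup_add add.commute[of "lookup c i"] add.assoc del: add_bit_eq_xor)
qed

text \<open>Multiplying one of \<open>g\<close>, \<open>h\<close> by a power of the other keeps the
  defect \<open>z\<close>. So the shift of larger 2-adic valuation can be made 0 mod
  \<open>2 ^ \<sigma>\<close>, the case of \<open>commutator_shift_0\<close>.\<close>

lemma commutator_finite_quotient:
  assumes M: "\<And>i. i < J \<Longrightarrow> 2 * 2 ^ \<mu> i dvd (2::int) ^ \<sigma>"
    and e: "eqv (2 ^ \<sigma>) J (mul h g) (mul (mul g h) (0, 0, z))"
    and g: "\<not> 2 ^ \<sigma> dvd fst g" and i: "i < J"
  shows "lookup z i = 0"
proof -
  note M' = dvd_mult_right[OF M]
  have swap: "eqv (2 ^ \<sigma>) J (mul g h) (mul (mul h g) (0, 0, z))"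
    if "eqv (2 ^ \<sigma>) J (mul h g) (mul (mul g h) (0, 0, z))" for g h
  proof -
    have "eqv (2 ^ \<sigma>) J (mul (mul (mul g h) (0, 0, z)) (0, 0, z)) (mul (mul h g) (0, 0, z))"
      using eqv_mul[OF M' eqv_sym[OF that] eqv_refl] .
    then show ?thesis by (cases "mul g h") (simp add: add.assoc)
  qed
  have "fst g \<noteq> 0" using g by auto
  then obtain a c where k: "fst g = 2 ^ a * c" "odd c" using odd_part by blast
  show ?thesis
  proof (cases "2 ^ \<sigma> dvd fst h \<or> 2 ^ a dvd fst h")
    case True
    then obtain u where u: "2 ^ \<sigma> dvd fst h + int u * fst g"
      using solve_pow2[OF k, of "fst h" \<sigma>] by (metis add.right_neutral mult_zero_left of_nat_0)
    let ?h = "mul h (pw g u)"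
    have "eqv (2 ^ \<sigma>) J (mul (mul h g) (pw g u)) (mul (mul (mul g h) (0, 0, z)) (pw g u))"
      by (rule eqv_mul[OF M' e eqv_refl])
    also have "mul (mul h g) (pw g u) = mul ?h g" by (simp only: mul_assoc pw_commute)
    also have "mul (mul (mul g h) (0, 0, z)) (pw g u) = mul (mul g ?h) (0, 0, z)"
      by (simp only: mul_assoc central)
    finally show ?thesis using u g i by (intro commutator_shift_0[OF M]) (auto simp: fst_mul fst_pw)
  next
    case False
    \<comment> \<open>The shift of \<open>h\<close> has the smaller valuation, so \<open>g\<close>
      is adjusted and the roles are exchanged; \<open>z\<close> is its own inverse.\<close>
    then have "fst h \<noteq> 0" by auto
    then obtain b c' where s: "fst h = 2 ^ b * c'" "odd c'" using odd_part by blast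
    have "b < a" using False s by (metis dvd_triv_left le_imp_power_dvd not_less dvd_trans)
    then have "2 ^ b dvd fst g" using k by (simp add: le_imp_power_dvd)
    then obtain u where u: "2 ^ \<sigma> dvd fst g + int u * fst h" using solve_pow2[OF s] by blast
    let ?g = "mul g (pw h u)"
    have "eqv (2 ^ \<sigma>) J (mul (mul g h) (pw h u)) (mul (mul (mul h g) (0, 0, z)) (pw h u))"
      by (rule eqv_mul[OF M' swap[OF e] eqv_refl])
    also have "mul (mul g h) (pw h u) = mul ?g h" by (simp only: mul_assoc pw_commute)
    also have "mul (mul (mul h g) (0, 0, z)) (pw h u) = mul (mul h ?g) (0, 0, z)"
      by (simp only: mul_assoc central)
    finally show ?thesis using u False i by (intro commutator_shift_0[OF M]) (auto simp: fst_mul fst_pw)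
  qed
qed

end

section \<open>Conjugacy in finite quotients\<close>

lemma bit_add_self: "(a::bit) + a = 0"
  by (cases a) auto

lemma f2_exchange:
  fixes a b c d :: "'c \<Rightarrow>\<^sub>0 bit"
  assumes "a + b = c + d"
  shows "c + a = d + b"
proof -
  have "(c + a) + (d + b) = (a + b) + (c + d)" by (simp only: ac_simps)
  then have "(c + a) + (d + b) = 0" using assms by simp
  then show ?thesis by (simp only: f2_add_eq_0_iff)
qed

lemma keys_mult_interval:
  fixes f g :: "int \<Rightarrow>\<^sub>0 bit"
  assumes "keys f \<subseteq> {a..b}" "keys g \<subseteq> {c..d}"
  shows "keys (f * g) \<subseteq> {a + c..b + d}"
  using keys_mult[of f g] assms by fastforce

lemma keys_star_interval: "keys f \<subseteq> {a..b} \<Longrightarrow> keys (star f) \<subseteq> {- b..- a}"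
  by (auto simp: keys_star)

lemma keys_T_interval: "keys f \<subseteq> {a..b} \<Longrightarrow> keys (T s * f) \<subseteq> {s + a..s + b}"
  by (auto simp: keys_T_mult)

context scale
begin

text \<open>A box containing the ball of radius \<open>n\<close>, see
  \<open>small_of_word\<close>.\<close>

fun small :: "int \<Rightarrow> el \<Rightarrow> bool"
  where "small n (k, f, c) \<longleftrightarrow> \<bar>k\<bar> \<le> n \<and> keys f \<subseteq> {- n..n} \<and> (\<forall>i\<in>keys c. 2 ^ \<nu> i \<le> n)"

lemma phi_star_mult: "phi (star p * f) = lam (star p * f) + lam (star f * p)"
  by (simp add: phi_def star_mult mult.commute)

lemma central_move: "mul (mul (mul a x) (0, 0, z)) g = mul a (mul (mul x g) (0, 0, z))"
  by (metis mul_assoc central)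

text \<open>Modulo the centre, conjugacy of pure lamps is translation, which the quotient detects
  because \<open>M\<close> exceeds the window. The remaining central defect lives in coordinates
  from \<open>J\<close> on and is removed by changing the lamps of the conjugator.\<close>

lemma conj_of_quotient_shift_0:
  fixes n :: int
  assumes M: "\<And>i. i < J \<Longrightarrow> 2 ^ \<mu> i dvd M" and n: "n \<ge> 1" "8 * n \<le> M"
    and J: "\<And>i. J \<le> i \<Longrightarrow> 16 * n < 2 ^ \<nu> i"
    and x: "small n (0, f1, c1)" and y: "small n (0, f2, c2)"
    and e: "eqv M J (mul h (0, f1, c1)) (mul (0, f2, c2) h)"
  shows "\<exists>h. mul h (0, f1, c1) = mul (0, f2, c2) h"
proof -
  obtain s q d where h: "h = (s, q, d)" by (cases h) auto
  have k1: "keys f1 \<subseteq> {- n..n}" and k2: "keys f2 \<subseteq> {- n..n}" using x y by auto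
  have large: "i \<notin> keys c1 \<and> i \<notin> keys c2" if "J \<le> i" for i
    using J[OF that] x y n by fastforce
  have "cg M (q + T s * f1) (f2 + q)" using e by (simp add: h)
  then have "cg M (q + (q + T s * f1)) (q + (f2 + q))" by (rule cg_add[OF cg_refl])
  then have cf: "cg M (T s * f1) f2" by (simp add: add.commute[of f2])
  show ?thesis
  proof (cases "f1 = 0")
    case True
    \<comment> \<open>Both elements are central, so conjugacy is equality; coordinates from
      \<open>J\<close> on vanish by size.\<close>
    then have "cg M 0 f2" using cf by simp
    then have "f2 = 0" using cg_small_eq[of M 0 f2 "- n" n] k2 n by simp
    have "lookup c1 i = lookup c2 i" for i
    proof (cases "i < J")
      case True
      have "lookup (d + c1) i = lookup (c2 + d) i"
        using e True by (simp add: h \<open>f1 = 0\<close> \<open>f2 = 0\<close>)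
      then show ?thesis by (simp add: lookup_add add.commute[of "lookup c2 i"] del: add_bit_eq_xor)
    next
      case False
      then show ?thesis using large by (simp add: in_keys_iff)
    qed
    then have "c1 = c2" by (rule poly_mapping_eqI)
    then have "mul unit (0, f1, c1) = mul (0, f2, c2) unit" using \<open>f1 = 0\<close> \<open>f2 = 0\<close> by simp
    then show ?thesis by blast
  next
    case False
    then have "keys f1 \<noteq> {}" using keys_f2_inject[of f1 0] by simp
    then obtain a where a: "a \<in> keys f1" by blast
    have "inj_on (\<lambda>k. k mod M) {s - n..s + n}" using n by (intro inj_on_mod_interval) simp
    then have "inj_on (\<lambda>k. k mod M) (keys (T s * f1))"
      using keys_T_interval[OF k1, of s] inj_on_subset by fastforce
    then have "(s + a) mod M \<in> keys (lin (\<lambda>k. T (k mod M)) (T s * f1))"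
      using a by (intro keys_fold_inj) (auto simp: keys_T_mult)
    then have "(s + a) mod M \<in> keys (lin (\<lambda>k. T (k mod M)) f2)" using cf fold_eq_iff by metis
    then obtain b where b: "b \<in> keys f2" "(s + a) mod M = b mod M"
      using keys_lin_subset[of "\<lambda>k. T (k mod M)" f2] by auto
    \<comment> \<open>The shift \<open>s\<close> is known only mod \<open>M\<close>. Matching a lamp
      of \<open>f1\<close> with one of \<open>f2\<close> gives a representative of size at most 2n,
      small enough to turn the congruence into an equality.\<close>
    define s' where "s' = b - a"
    have "M dvd s' - s" using b(2) by (simp add: s'_def mod_eq_dvd_iff algebra_simps dvd_diff_commute)
    then have "cg M (T s' * f1) (T s * f1)" by (intro cg_mult cg_T) simp_all
    then have "cg M (T s' * f1) f2" using cf by (rule cg_trans)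
    moreover have "\<bar>s'\<bar> \<le> 2 * n" using a b(1) k1 k2 by (force simp: s'_def)
    then have "keys (T s' * f1) \<subseteq> {- 3 * n..3 * n}" by (intro order_trans[OF keys_T_interval[OF k1]]) auto
    moreover have "keys f2 \<subseteq> {- 3 * n..3 * n}" using k2 n by auto
    ultimately have sf: "T s' * f1 = f2" using n by (intro cg_small_eq) auto
    \<comment> \<open>The central defect of the conjugator with shift \<open>s'\<close> and lamps
      \<open>q\<close>.\<close>
    define w where "w = c1 + c2 + phi (star q * f2)"
    have "lookup w i = 0" if "i < J" for i
    proof -
      have "lookup (d + c1 + lam (star q * (T s * f1))) i = lookup (c2 + d + lam (star f2 * q)) i"
        using e that by (simp add: h)
      moreover have "lookup (lam (star q * (T s * f1))) i = lookup (lam (star q * f2)) i"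
        using cf by (intro lam_cg[OF _ M[OF that]] cg_mult) simp_all
      ultimately have "lookup (d + (c1 + lam (star q * f2))) i = lookup (d + (c2 + lam (star f2 * q))) i"
        by (simp add: lookup_add ac_simps del: add_bit_eq_xor)
      then have "lookup (c1 + lam (star q * f2)) i = lookup (c2 + lam (star f2 * q)) i"
        by (simp add: lookup_add del: add_bit_eq_xor)
      moreover have "w = (c1 + lam (star q * f2)) + (c2 + lam (star f2 * q))"
        by (simp add: w_def phi_def star_mult mult.commute ac_simps)
      ultimately show ?thesis by (simp add: lookup_add[of "c1 + lam (star q * f2)"] bit_add_self del: add_bit_eq_xor)
    qed
    then have J': "J \<le> i" if "i \<in> keys w" for i using that by (meson in_keys_iff not_less)
    have "16 * (n - - n + 1) \<le> 2 ^ \<mu> i" if "i \<in> keys w" for i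
    proof -
      \<comment> \<open>From n_i > 16n follows m_i > 64n, which exceeds 16 times the window width 2n
        + 1.\<close>
      have "64 * n \<le> 2 ^ \<mu> i" using J[OF J'[OF that]] nu_pow_mu[of i] by linarith
      then show ?thesis using n(1) by simp
    qed
    moreover have "f2 \<noteq> 0" using b(1) by auto
    ultimately obtain p where p: "phi (p * f2) = w" using phi_ideal_surj[OF _ k2, of w] by blast
    let ?q = "q + star p"
    have "phi (star ?q * f2) = phi (star q * f2) + w"
      by (simp add: star_add distrib_right phi_add p)
    then have "phi (star ?q * f2) = c1 + c2" by (simp add: w_def ac_simps)
    then have "lam (star ?q * f2) + lam (star f2 * ?q) = c1 + c2" unfolding phi_star_mult .
    then have "c1 + lam (star ?q * f2) = c2 + lam (star f2 * ?q)"
      by (rule f2_exchange)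
    then have "mul (s', ?q, 0) (0, f1, c1) = mul (0, f2, c2) (s', ?q, 0)"
      by (simp add: sf add.commute)
    then show ?thesis by blast
  qed
qed

text \<open>For a common shift \<open>k\<close> other than 0, the lamplighter quotient modulo |k|
  gives a conjugator up to the centre. Its defect vanishes below \<open>J\<close> by
  \<open>commutator_finite_quotient\<close> and from \<open>J\<close> on by degree bounds.\<close>

lemma conj_of_quotients:
  fixes n :: int
  assumes M: "\<And>i. i < J \<Longrightarrow> 2 * 2 ^ \<mu> i dvd (2::int) ^ \<sigma>" and n: "n \<ge> 1" "8 * n \<le> 2 ^ \<sigma>"
    and J: "\<And>i. J \<le> i \<Longrightarrow> 16 * n < 2 ^ \<nu> i"
    and x: "small n x" and y: "small n y"
    and e: "eqv (2 ^ \<sigma>) J (mul h x) (mul y h)"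
    and e': "\<And>k. 1 \<le> k \<Longrightarrow> k \<le> n \<Longrightarrow> \<exists>h. eqv k 0 (mul h x) (mul y h)"
  shows "\<exists>h. mul h x = mul y h"
proof -
  note M' = dvd_mult_right[OF M]
  obtain k f1 c1 k' f2 c2 where xy: "x = (k, f1, c1)" "y = (k', f2, c2)" by (cases x; cases y) auto
  have "2 ^ \<sigma> dvd k - k'" using e by (cases h) (auto simp: xy)
  then have kk: "k' = k" using x y n zdvd_imp_le[of "2 ^ \<sigma>" "k - k'"] zdvd_imp_le[of "2 ^ \<sigma>" "k' - k"]
    by (force simp: xy dvd_diff_commute)
  show ?thesis
  proof (cases "k = 0")
    case True
    show ?thesis unfolding xy kk True
      using x y e by (intro conj_of_quotient_shift_0[OF M' n J]) (simp_all add: xy kk True)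
  next
    case False
    have kn: "\<bar>k\<bar> \<le> n" using x by (simp add: xy)
    have k1: "keys f1 \<subseteq> {- n..n}" and k2: "keys f2 \<subseteq> {- n..n}" using x y by (auto simp: xy)
    let ?K = "\<bar>k\<bar>"
    \<comment> \<open>Modulo |k| both elements have trivial shift, so conjugation only translates
      lamps.\<close>
    obtain g where "eqv ?K 0 (mul g x) (mul y g)" using e'[OF _ kn] False by force
    then obtain s q d where "cg ?K (q + T s * f1) (f2 + T k * q)" by (cases g) (auto simp: xy kk)
    moreover have "cg ?K q (T k * q)" using cg_mult[OF cg_T[of ?K 0 k], of q q] by simp
    ultimately have "cg ?K (q + T s * f1 + q) (f2 + T k * q + T k * q)" by (rule cg_add)
    then have "cg ?K (T s * f1) f2" by (simp add: add.assoc add.commute[of q] add.left_commute)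
    \<comment> \<open>The translation matters only mod |k|; a small representative keeps all
      supports within a few multiples of n.\<close>
    moreover define s' where "s' = s mod ?K"
    have "?K dvd s' - s" by (simp add: s'_def mod_eq_dvd_iff[symmetric])
    then have "cg ?K (T s' * f1) (T s * f1)" by (intro cg_mult cg_T) simp_all
    ultimately have "cg ?K (T s' * f1) f2" by (metis cg_trans)
    then have "T ?K + 1 dvd T s' * f1 + f2" by (simp only: cg_def)
    moreover have "T k + 1 dvd T ?K + 1" by (rule T_plus_1_dvd) simp
    ultimately have "T k + 1 dvd T s' * f1 + f2" using dvd_trans by blast
    then obtain q' where q': "T s' * f1 + f2 = (T k + 1) * q'" by (auto elim: dvdE)
    have s': "0 \<le> s'" "s' < ?K" using False by (auto simp: s'_def)
    have ks: "keys (T s' * f1) \<subseteq> {- n..2 * n}"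
      using s' kn by (intro order_trans[OF keys_T_interval[OF k1]]) auto
    then have "keys ((T k + 1) * q') \<subseteq> {- n..2 * n}"
      using k2 n unfolding q'[symmetric] keys_add_f2 by fastforce
    then have kq: "keys q' \<subseteq> {- n..2 * n}" using False by (rule keys_factor)
    define z where "z = c1 + c2 + lam (star q' * (T s' * f1)) + lam (star f2 * (T k * q'))"
    let ?h = "(s', q', 0) :: el"
    have "q' + T s' * f1 = f2 + T k * q'"
    proof -
      have "T s' * f1 + f2 = T k * q' + q'" unfolding q' by (simp only: distrib_right mult_1)
      then show ?thesis by (metis f2_exchange add.commute)
    qed
    then have hx: "mul ?h x = mul (mul y ?h) (0, 0, z)"
      by (simp add: xy kk z_def ac_simps)
    have z0: "lookup z i = 0" if "i < J" for i
    proof -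
      \<comment> \<open>In the quotient \<open>h\<close> conjugates exactly, whereas
        \<open>?h\<close> does so up to \<open>z\<close>. Hence \<open>?g\<close> commutes with
        \<open>x\<close> up to \<open>z\<close>.\<close>
      let ?g = "mul (inv_el ?h) h"
      have h: "h = mul ?h ?g" by (simp only: mul_assoc[symmetric] inv_el_right mul_unit_left)
      have hx1: "mul h x = mul ?h (mul ?g x)" by (subst h) (simp only: mul_assoc)
      have hy1: "mul y h = mul ?h (mul (mul x ?g) (0, 0, z))"
      proof -
        have "mul (mul ?h x) (0, 0, z) = mul y ?h"
          unfolding hx by (simp only: mul_assoc) (simp add: mul.simps)
        then have "mul (mul y ?h) ?g = mul (mul (mul ?h x) (0, 0, z)) ?g" by simp
        moreover have "mul (mul (mul ?h x) (0, 0, z)) ?g = mul ?h (mul (mul x ?g) (0, 0, z))"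
          by (rule central_move)
        moreover have "mul y h = mul (mul y ?h) ?g" unfolding mul_assoc h[symmetric] ..
        ultimately show ?thesis by (simp only:)
      qed
      have "eqv (2 ^ \<sigma>) J (mul ?h (mul ?g x)) (mul ?h (mul (mul x ?g) (0, 0, z)))"
        by (subst hx1[symmetric], subst hy1[symmetric], rule e)
      with M' have e1: "eqv (2 ^ \<sigma>) J (mul ?g x) (mul (mul x ?g) (0, 0, z))"
        by (rule eqv_mul_left_cancel)
      have "\<not> 2 ^ \<sigma> dvd fst x"
        using False kn n zdvd_imp_le[of "2 ^ \<sigma>" ?K] by (auto simp: xy)
      with M e1 show ?thesis using that by (rule commutator_finite_quotient)
    qed
    have "lookup z i = 0" for i
    proof (cases "i < J")
      case False
      \<comment> \<open>All exponents fed into \<open>lam\<close> are at most 4n in absolute value,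
        too small to reach n_i > 16n.\<close>
      then have i: "16 * n < 2 ^ \<nu> i" using J by simp
      have "keys (star q' * (T s' * f1)) \<subseteq> {- 2 * n + - n..n + 2 * n}"
        using keys_mult_interval[OF keys_star_interval[OF kq] ks] by simp
      then have l1: "i \<notin> keys (lam (star q' * (T s' * f1)))"
        using lam_bound[of "star q' * (T s' * f1)" "3 * n" i] i n by fastforce
      have "keys (T k * q') \<subseteq> {- 2 * n..3 * n}"
        using kn by (intro order_trans[OF keys_T_interval[OF kq]]) auto
      from keys_mult_interval[OF keys_star_interval[OF k2] this]
      have "keys (star f2 * (T k * q')) \<subseteq> {- 4 * n..4 * n}" by (rule order_trans) (use n in auto)
      then have l2: "i \<notin> keys (lam (star f2 * (T k * q')))"
        using lam_bound[of "star f2 * (T k * q')" "4 * n" i] i n by fastforce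
      have "i \<notin> keys c1" "i \<notin> keys c2" using x y i n by (fastforce simp: xy)+
      then show ?thesis using l1 l2 by (simp add: z_def lookup_add in_keys_iff)
    qed (rule z0)
    then have "z = 0" by (intro poly_mapping_eqI) simp
    then show ?thesis using hx by auto
  qed
qed

text \<open>A commutator of the given element with suitable lamps is e_j. \<open>N\<close> is a bare
  set of triples so that preimages under \<open>enc\<close> can be inserted.\<close>

lemma normal_contains_single:
  assumes mul: "\<And>x y. x \<in> N \<Longrightarrow> y \<in> N \<Longrightarrow> mul x y \<in> N" and inv: "\<And>x. x \<in> N \<Longrightarrow> inv_el x \<in> N"
    and conj: "\<And>x g. x \<in> N \<Longrightarrow> mul (mul g x) (inv_el g) \<in> N"
    and f: "(0, f, c) \<in> N" "f \<noteq> 0" "keys f \<subseteq> {\<alpha>..\<beta>}" and small: "16 * (\<beta> - \<alpha> + 1) \<le> 2 ^ \<mu> j"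
  shows "(0, 0, Poly_Mapping.single j 1) \<in> N"
proof -
  let ?x = "(0, f, c) :: el" and ?z = "(0, 0, Poly_Mapping.single j 1) :: el"
  obtain q where "phi (q * f) = Poly_Mapping.single j 1"
    using single_in_phi_ideal[OF f(2,3) small] by blast
  then have g: "mul (0, star q, 0) ?x = mul (mul ?x (0, star q, 0)) ?z"
    using mul_commute_base[of "star q" 0 f c] by simp
  have "mul (mul (0, star q, 0) ?x) (inv_el (0, star q, 0)) = mul ?x ?z"
    unfolding g by (simp only: mul_assoc central inv_el_right) (simp only: central[symmetric] mul_unit_right)
  then have "mul ?x ?z \<in> N" using conj[OF f(1)] by metis
  then show ?thesis using mul[OF inv[OF f(1)]] mul_inv_el_left by metis
qed

end

section \<open>Conjugacy and words in groups\<close>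

lemma (in group) conjugate_in_iff:
  assumes "x \<in> carrier G" "y \<in> carrier G"
  shows "conjugate_in G x y \<longleftrightarrow> (\<exists>h\<in>carrier G. h \<otimes> x = y \<otimes> h)"
proof -
  have "y = h \<otimes> x \<otimes> inv h \<longleftrightarrow> h \<otimes> x = y \<otimes> h" if "h \<in> carrier G" for h
    using that assms inv_solve_right[of y "h \<otimes> x" h] by auto
  then show ?thesis unfolding conjugate_in_def by blast
qed

text \<open>Copies the structure along an injective \<open>f\<close>; this moves both the finite
  quotients and the group itself to the natural numbers.\<close>

definition transport :: "('a, 'b) monoid_scheme \<Rightarrow> ('a \<Rightarrow> 'c) \<Rightarrow> 'c monoid"
  where "transport K f =
    \<lparr>carrier = f ` carrier K,
     monoid.mult = (\<lambda>a b. f (inv_into (carrier K) f a \<otimes>\<^bsub>K\<^esub> inv_into (carrier K) f b)),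
     one = f \<one>\<^bsub>K\<^esub>\<rparr>"

lemma carrier_transport: "carrier (transport K f) = f ` carrier K"
  and one_transport: "\<one>\<^bsub>transport K f\<^esub> = f \<one>\<^bsub>K\<^esub>"
  by (simp_all add: transport_def)

lemma mult_transport:
  assumes "inj_on f (carrier K)" "x \<in> carrier K" "y \<in> carrier K"
  shows "f x \<otimes>\<^bsub>transport K f\<^esub> f y = f (x \<otimes>\<^bsub>K\<^esub> y)"
  using assms by (simp add: transport_def)

lemma group_transport:
  assumes "group K" "inj_on f (carrier K)"
  shows "group (transport K f)"
proof -
  interpret K: group K by fact
  show ?thesis
  proof (rule groupI)
    fix x assume "x \<in> carrier (transport K f)"
    then obtain a where "a \<in> carrier K" "x = f a" by (auto simp: carrier_transport)
    then show "\<exists>y\<in>carrier (transport K f). y \<otimes>\<^bsub>transport K f\<^esub> x = \<one>\<^bsub>transport K f\<^esub>"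
      using mult_transport[OF assms(2), of "inv\<^bsub>K\<^esub> a" a]
      by (auto simp: carrier_transport one_transport intro!: bexI[of _ "inv\<^bsub>K\<^esub> a"])
  qed (auto simp: carrier_transport one_transport mult_transport[OF assms(2)] K.m_assoc)
qed

lemma conjugate_in_transport:
  assumes "group K" "inj_on f (carrier K)" "x \<in> carrier K" "y \<in> carrier K"
  shows "conjugate_in (transport K f) (f x) (f y) \<longleftrightarrow> conjugate_in K x y"
proof -
  have "f h \<otimes>\<^bsub>transport K f\<^esub> f x = f y \<otimes>\<^bsub>transport K f\<^esub> f h \<longleftrightarrow> h \<otimes>\<^bsub>K\<^esub> x = y \<otimes>\<^bsub>K\<^esub> h"
    if "h \<in> carrier K" for h
  proof -
    have "h \<otimes>\<^bsub>K\<^esub> x \<in> carrier K" "y \<otimes>\<^bsub>K\<^esub> h \<in> carrier K"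
      using assms that group.is_monoid monoid.m_closed by metis+
    then show ?thesis using assms that inj_on_eq_iff[OF assms(2)] by (simp add: mult_transport)
  qed
  then show ?thesis
    using assms group.conjugate_in_iff[OF group_transport[OF assms(1,2)], of "f x" "f y"]
      group.conjugate_in_iff[OF assms(1), of x y]
    by (auto simp: carrier_transport)
qed

lemma (in group) conjugacy_separableI:
  assumes "\<And>x y. x \<in> carrier G \<Longrightarrow> y \<in> carrier G \<Longrightarrow> \<not> conjugate_in G x y \<Longrightarrow>
    \<exists>N. N \<lhd> G \<and> finite (rcosets N) \<and> \<not> conjugate_in (G Mod N) (N #> x) (N #> y)"
  shows "conjugacy_separable G"
  unfolding conjugacy_separable_def
proof (intro ballI impI)
  fix x y assume xy: "x \<in> carrier G" "y \<in> carrier G" "\<not> conjugate_in G x y"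
  then obtain N where N: "N \<lhd> G" "finite (rcosets N)" "\<not> conjugate_in (G Mod N) (N #> x) (N #> y)"
    using assms by blast
  interpret N: normal N G by fact
  have Q: "group (G Mod N)" by (rule N.factorgroup_is_group)
  have cQ: "carrier (G Mod N) = rcosets N" by (simp add: FactGroup_def)
  obtain f :: "'a set \<Rightarrow> nat" where f: "inj_on f (carrier (G Mod N))"
    using finite_imp_inj_to_nat_seg[OF N(2)] unfolding cQ by blast
  let ?H = "transport (G Mod N) f" and ?p = "\<lambda>a. f (N #> a)"
  have in_Q: "N #> a \<in> carrier (G Mod N)" if "a \<in> carrier G" for a
    using that by (auto simp: cQ RCOSETS_def)
  have "?p \<in> hom G ?H"
  proof (rule homI)
    fix a b assume "a \<in> carrier G" "b \<in> carrier G"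
    then show "?p (a \<otimes> b) = ?p a \<otimes>\<^bsub>?H\<^esub> ?p b"
      using mult_transport[OF f in_Q in_Q, of a b] by (simp add: FactGroup_def N.rcos_sum)
  qed (simp add: carrier_transport in_Q)
  moreover have "?p ` carrier G = carrier ?H"
    unfolding carrier_transport cQ RCOSETS_def by auto
  ultimately have "?p \<in> epi G ?H" by (simp add: epi_def)
  moreover have "group ?H" by (rule group_transport[OF Q f])
  moreover have "finite (carrier ?H)" using N(2) by (simp add: carrier_transport cQ)
  moreover have "\<not> conjugate_in ?H (?p x) (?p y)"
    using N(3) conjugate_in_transport[OF Q f in_Q in_Q] xy by blast
  ultimately show "\<exists>(H :: nat monoid) \<phi>. group H \<and> finite (carrier H) \<and> \<phi> \<in> epi G H \<and>
      \<not> conjugate_in H (\<phi> x) (\<phi> y)" by blast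
qed

text \<open>The fibres of \<open>\<Phi>\<close> form a congruence and \<open>N\<close> is the fibre
  of the identity. This gives a quotient of controlled index from a normal form for its
  elements.\<close>

lemma (in group) quotient_of_congruence:
  fixes \<Phi> :: "'a \<Rightarrow> 'c"
  assumes fin: "finite (\<Phi> ` carrier G)"
    and cong: "\<And>a b c d. \<lbrakk>a \<in> carrier G; b \<in> carrier G; c \<in> carrier G; d \<in> carrier G;
      \<Phi> a = \<Phi> b; \<Phi> c = \<Phi> d\<rbrakk> \<Longrightarrow> \<Phi> (a \<otimes> c) = \<Phi> (b \<otimes> d)"
    and x: "x \<in> carrier G" and y: "y \<in> carrier G"
    and sep: "\<And>h. h \<in> carrier G \<Longrightarrow> \<Phi> (h \<otimes> x) \<noteq> \<Phi> (y \<otimes> h)"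
  shows "\<exists>N. N \<lhd> G \<and> finite (rcosets N) \<and> card (rcosets N) \<le> card (\<Phi> ` carrier G) \<and>
    \<not> conjugate_in (G Mod N) (N #> x) (N #> y)"
proof -
  define N where "N = {a \<in> carrier G. \<Phi> a = \<Phi> \<one>}"
  have inv_eq: "\<Phi> (inv a) = \<Phi> (inv b)" if "a \<in> carrier G" "b \<in> carrier G" "\<Phi> a = \<Phi> b" for a b
  proof -
    have "\<Phi> (inv a \<otimes> b \<otimes> inv b) = \<Phi> (inv a \<otimes> a \<otimes> inv b)" using that by (intro cong) auto
    then show ?thesis using that by (simp add: m_assoc)
  qed
  have sub: "subgroup N G"
  proof
    fix a b assume "a \<in> N" "b \<in> N"
    then show "a \<otimes> b \<in> N" using cong[of a \<one> b \<one>] by (auto simp: N_def)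
  next
    fix a assume "a \<in> N"
    then show "inv a \<in> N" using inv_eq[of a \<one>] by (auto simp: N_def)
  qed (auto simp: N_def)
  have N: "N \<lhd> G"
  proof (rule normal_invI[OF sub])
    fix a h assume "a \<in> carrier G" "h \<in> N"
    then show "a \<otimes> h \<otimes> inv a \<in> N"
      using cong[of "a \<otimes> h" "a \<otimes> \<one>" "inv a" "inv a"] cong[of a a h \<one>] by (auto simp: N_def)
  qed
  have in_N: "b \<otimes> inv a \<in> N" if "a \<in> carrier G" "b \<in> carrier G" "\<Phi> a = \<Phi> b" for a b
  proof -
    have "\<Phi> (b \<otimes> inv a) = \<Phi> (a \<otimes> inv a)"
      using that by (intro cong) simp_all
    then show ?thesis using that(1,2) by (simp add: N_def)
  qed
  have N_D: "a \<in> carrier G" "\<Phi> a = \<Phi> \<one>" if "a \<in> N" for a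
    using that by (simp_all add: N_def)
  interpret N: normal N G by (rule N)
  have coset: "N #> a = N #> b" if "a \<in> carrier G" "b \<in> carrier G" "\<Phi> a = \<Phi> b" for a b
  proof -
    have "b \<otimes> inv a \<otimes> a \<in> N #> a" using rcosI[OF in_N[OF that] N.subset] that by blast
    then have "b \<in> N #> a" using that by (simp add: m_assoc)
    then show ?thesis using that sub by (intro repr_independence)
  qed
  \<comment> \<open>Elements with equal value lie in one coset, so there are at most as many cosets
    as values.\<close>
  have "rcosets N = (\<lambda>v. N #> (SOME a. a \<in> carrier G \<and> \<Phi> a = v)) ` \<Phi> ` carrier G"
  proof -
    have "N #> a = N #> (SOME b. b \<in> carrier G \<and> \<Phi> b = \<Phi> a)" if "a \<in> carrier G" for a
      using someI[of "\<lambda>b. b \<in> carrier G \<and> \<Phi> b = \<Phi> a" a] that by (intro coset) auto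
    then show ?thesis unfolding RCOSETS_def image_image by auto
  qed
  then have card: "finite (rcosets N)" "card (rcosets N) \<le> card (\<Phi> ` carrier G)"
    using fin by (auto intro: card_image_le)
  have "\<not> conjugate_in (G Mod N) (N #> x) (N #> y)"
  proof
    assume c: "conjugate_in (G Mod N) (N #> x) (N #> y)"
    have "N #> a \<in> carrier (G Mod N)" if "a \<in> carrier G" for a
      using that by (auto simp: FactGroup_def RCOSETS_def)
    with c x y group.conjugate_in_iff[OF N.factorgroup_is_group, of "N #> x" "N #> y"]
    obtain H where H: "H \<in> carrier (G Mod N)" "H \<otimes>\<^bsub>G Mod N\<^esub> (N #> x) = (N #> y) \<otimes>\<^bsub>G Mod N\<^esub> H"
      by blast
    then obtain h where h: "h \<in> carrier G" "H = N #> h" by (auto simp: FactGroup_def RCOSETS_def)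
    then have "N #> (h \<otimes> x) = N #> (y \<otimes> h)"
      using H(2) x y by (simp add: FactGroup_def N.rcos_sum)
    then have "h \<otimes> x \<in> N #> (y \<otimes> h)" using rcos_self[of "h \<otimes> x" N] sub h x by simp
    then obtain n where "n \<in> N" "h \<otimes> x = n \<otimes> (y \<otimes> h)" by (auto simp: r_coset_def)
    then have "\<Phi> (h \<otimes> x) = \<Phi> (y \<otimes> h)"
      using cong[of n \<one> "y \<otimes> h" "y \<otimes> h"] N_D[of n] h y by simp
    then show False using sep h by blast
  qed
  then show ?thesis using N card by blast
qed

lemma Conj_elt_le:
  assumes "N \<lhd> G" "finite (rcosets\<^bsub>G\<^esub> N)" "\<not> conjugate_in (G Mod N) (N #>\<^bsub>G\<^esub> x) (N #>\<^bsub>G\<^esub> y)"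
    "card (rcosets\<^bsub>G\<^esub> N) \<le> B" "\<not> conjugate_in G x y"
  shows "Conj_elt G x y \<le> B"
  unfolding Conj_elt_def using assms by (auto intro: le_trans[OF Least_le])

text \<open>A normal subgroup containing \<open>x\<close> identifies \<open>x\<close> with the
  identity, so separating ones avoid \<open>x\<close>. Assumption \<open>sep\<close> makes the
  minimum exist.\<close>

lemma (in group) le_Conj_elt_one:
  assumes sep: "\<exists>N. N \<lhd> G \<and> finite (rcosets N) \<and> \<not> conjugate_in (G Mod N) (N #> x) (N #> \<one>)"
    and x: "x \<in> carrier G" "x \<noteq> \<one>"
    and le: "\<And>N. N \<lhd> G \<Longrightarrow> finite (rcosets N) \<Longrightarrow> x \<notin> N \<Longrightarrow> B \<le> card (rcosets N)"
  shows "B \<le> Conj_elt G x \<one>"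
proof -
  have "\<not> conjugate_in G x \<one>" using x by (auto simp: conjugate_in_iff)
  moreover have "B \<le> (LEAST k. \<exists>N. N \<lhd> G \<and> finite (rcosets N) \<and> k = card (rcosets N) \<and>
      \<not> conjugate_in (G Mod N) (N #> x) (N #> \<one>))"
  proof (rule LeastI2_ex)
    fix k assume "\<exists>N. N \<lhd> G \<and> finite (rcosets N) \<and> k = card (rcosets N) \<and>
      \<not> conjugate_in (G Mod N) (N #> x) (N #> \<one>)"
    then obtain N where N: "N \<lhd> G" "finite (rcosets N)" "k = card (rcosets N)"
      "\<not> conjugate_in (G Mod N) (N #> x) (N #> \<one>)" by blast
    interpret N: normal N G by fact
    have "x \<notin> N"
    proof
      assume "x \<in> N"
      then have eq: "N #> x = N" "N #> \<one> = N"
        using coset_join2[OF _ N.subgroup_axioms] x N.subset by auto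
      have "N \<in> carrier (G Mod N)" using N.subgroup_in_rcosets[OF is_group] by (simp add: FactGroup_def)
      then have "conjugate_in (G Mod N) N N"
        by (subst group.conjugate_in_iff[OF N.factorgroup_is_group]) blast+
      then show False using N(4) eq by simp
    qed
    then show "B \<le> k" using le N by blast
  qed (use sep in blast)
  ultimately show ?thesis by (simp add: Conj_elt_def)
qed

section \<open>Words and balls\<close>

definition word :: "('a, 'b) monoid_scheme \<Rightarrow> 'a set \<Rightarrow> 'a \<Rightarrow> nat \<Rightarrow> bool"
  where "word G S g l \<longleftrightarrow> (\<exists>w. set w \<subseteq> S \<union> (\<lambda>s. inv\<^bsub>G\<^esub> s) ` S \<and> length w = l \<and>
    foldr (\<otimes>\<^bsub>G\<^esub>) w \<one>\<^bsub>G\<^esub> = g)"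

lemma word_norm_le: "word G S g l \<Longrightarrow> word_norm G S g \<le> l"
  unfolding word_def word_norm_def by (rule Least_le)

lemma word_norm_word: "word G S g l \<Longrightarrow> word G S g (word_norm G S g)"
  unfolding word_def word_norm_def by (rule LeastI)

context group
begin

lemma foldr_closed: "set w \<subseteq> carrier G \<Longrightarrow> foldr (\<otimes>) w \<one> \<in> carrier G"
  by (induction w) auto

lemma word_one: "word G S \<one> 0"
  by (simp add: word_def)

lemma word_gen: "s \<in> S \<union> (\<lambda>s. inv s) ` S \<Longrightarrow> S \<subseteq> carrier G \<Longrightarrow> word G S s 1"
  unfolding word_def by (intro exI[of _ "[s]"]) auto

lemma word_mult:
  assumes S: "S \<subseteq> carrier G" and "word G S x k" "word G S y l"
  shows "word G S (x \<otimes> y) (k + l)"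
proof -
  obtain u v where u: "set u \<subseteq> S \<union> (\<lambda>s. inv s) ` S" "length u = k" "foldr (\<otimes>) u \<one> = x"
    and v: "set v \<subseteq> S \<union> (\<lambda>s. inv s) ` S" "length v = l" "foldr (\<otimes>) v \<one> = y"
    using assms by (auto simp: word_def)
  have S': "S \<union> (\<lambda>s. inv s) ` S \<subseteq> carrier G" using S by auto
  have y: "y \<in> carrier G" using foldr_closed[of v] v(1,3) S' by blast
  have "foldr (\<otimes>) (w @ v) \<one> = foldr (\<otimes>) w \<one> \<otimes> y" if "set w \<subseteq> carrier G" for w
    using that
  proof (induction w)
    case Nil
    then show ?case using v(3) y by simp
  next
    case (Cons a w)
    then show ?case using y foldr_closed[of w] by (simp add: m_assoc)
  qed
  from this[of u] show ?thesis
    unfolding word_def using u v S' by (intro exI[of _ "u @ v"]) auto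
qed

lemma generate_word:
  assumes S: "S \<subseteq> carrier G" and "g \<in> generate G S"
  shows "\<exists>l. word G S g l"
  using assms(2)
proof (induction g rule: generate.induct)
  case one
  then show ?case using word_one by blast
next
  case (incl h)
  then show ?case using word_gen[of h S] S by blast
next
  case (inv h)
  then show ?case using word_gen[of "inv h" S] S by blast
next
  case (eng h1 h2)
  then show ?case using word_mult[OF S] by blast
qed

lemma finite_Conj_elts:
  assumes S: "finite S" "S \<subseteq> carrier G" and gen: "generate G S = carrier G"
  shows "finite {Conj_elt G x y | x y. x \<in> carrier G \<and> y \<in> carrier G \<and>
    word_norm G S x \<le> n \<and> word_norm G S y \<le> n}" (is "finite ?A")
proof -
  let ?S = "S \<union> (\<lambda>s. inv s) ` S"
  define B where "B = (\<lambda>w. foldr (\<otimes>) w \<one>) ` {w. set w \<subseteq> ?S \<and> length w \<le> n}"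
  have in_B: "x \<in> B" if x: "x \<in> carrier G" "word_norm G S x \<le> n" for x
  proof -
    obtain l where "word G S x l" using generate_word[OF S(2)] x gen by blast
    from word_norm_word[OF this] obtain w where w: "set w \<subseteq> ?S" "length w = word_norm G S x" "foldr (\<otimes>) w \<one> = x"
      unfolding word_def by blast
    then have "w \<in> {w. set w \<subseteq> ?S \<and> length w \<le> n}" using x(2) by simp
    then show ?thesis unfolding B_def by (rule rev_image_eqI) (simp add: w(3))
  qed
  have "finite {w. set w \<subseteq> ?S \<and> length w \<le> n}" using S by (intro finite_lists_length_le) simp
  then have "finite ((\<lambda>(x, y). Conj_elt G x y) ` (B \<times> B))" by (simp add: B_def)
  moreover have "?A \<subseteq> (\<lambda>(x, y). Conj_elt G x y) ` (B \<times> B)"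
  proof
    fix v assume "v \<in> ?A"
    then obtain x y where v: "v = Conj_elt G x y" and "x \<in> carrier G" "y \<in> carrier G"
      "word_norm G S x \<le> n" "word_norm G S y \<le> n" by auto
    then have "(x, y) \<in> B \<times> B" using in_B by simp
    then show "v \<in> (\<lambda>(x, y). Conj_elt G x y) ` (B \<times> B)" unfolding v by (rule rev_image_eqI) simp
  qed
  ultimately show ?thesis by (rule finite_subset[rotated])
qed

lemma Conj_fun_le:
  assumes S: "finite S" "S \<subseteq> carrier G" and gen: "generate G S = carrier G"
    and le: "\<And>x y. \<lbrakk>x \<in> carrier G; y \<in> carrier G; word_norm G S x \<le> n; word_norm G S y \<le> n\<rbrakk>
      \<Longrightarrow> Conj_elt G x y \<le> B"
  shows "Conj_fun G S n \<le> B"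
proof -
  have "word_norm G S \<one> \<le> n" using word_norm_le[OF word_one] by (meson le0 le_trans)
  then have "{Conj_elt G x y | x y. x \<in> carrier G \<and> y \<in> carrier G \<and>
    word_norm G S x \<le> n \<and> word_norm G S y \<le> n} \<noteq> {}" by auto
  then show ?thesis unfolding Conj_fun_def
    using finite_Conj_elts[OF S gen] le by (subst Max_le_iff) auto
qed

lemma le_Conj_fun:
  assumes S: "finite S" "S \<subseteq> carrier G" and gen: "generate G S = carrier G"
    and "x \<in> carrier G" "y \<in> carrier G" "word_norm G S x \<le> n" "word_norm G S y \<le> n"
  shows "Conj_elt G x y \<le> Conj_fun G S n"
  unfolding Conj_fun_def using finite_Conj_elts[OF S gen] assms(4-) by (intro Max_ge) auto

end

section \<open>The group on the natural numbers\<close>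

text \<open>Over two elements the supports determine the polynomials, so the shift and two finite
  lists code an element.\<close>

definition enc :: "el \<Rightarrow> nat"
  where "enc = (\<lambda>(k, f, c). to_nat (k, sorted_list_of_set (keys f), sorted_list_of_set (keys c)))"

lemma inj_enc: "inj enc"
proof (rule injI)
  fix x y assume e: "enc x = enc y"
  obtain k f c k' f' c' where xy: "x = (k, f, c)" "y = (k', f', c')" by (cases x; cases y) auto
  have "k = k'" "sorted_list_of_set (keys f) = sorted_list_of_set (keys f')"
    "sorted_list_of_set (keys c) = sorted_list_of_set (keys c')"
    using e by (simp_all add: enc_def xy)
  then have "k = k'" "keys f = keys f'" "keys c = keys c'"
    using sorted_list_of_set_inject finite_keys by blast+
  then show "x = y" by (simp add: xy keys_f2_inject)
qed

lemma card_keys_subset: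
  fixes A :: "int set"
  assumes "finite A"
  shows "finite {f :: int \<Rightarrow>\<^sub>0 bit. keys f \<subseteq> A} \<and> card {f :: int \<Rightarrow>\<^sub>0 bit. keys f \<subseteq> A} = 2 ^ card A"
proof -
  let ?F = "{f :: int \<Rightarrow>\<^sub>0 bit. keys f \<subseteq> A}"
  have "bij_betw keys ?F (Pow A)"
  proof (rule bij_betwI')
    fix X assume X: "X \<in> Pow A"
    then have "finite X" using assms finite_subset by auto
    then have "finite {k. (if k \<in> X then 1 else 0 :: bit) \<noteq> 0}" by simp
    then have "keys (Abs_poly_mapping (\<lambda>k. if k \<in> X then 1 else 0 :: bit)) = X"
      by (auto simp: in_keys_iff split: if_splits)
    then show "\<exists>f\<in>?F. X = keys f" using X by (intro bexI[of _ "Abs_poly_mapping (\<lambda>k. if k \<in> X then 1 else 0)"]) auto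
  qed (auto simp: keys_f2_inject)
  then show ?thesis using assms by (metis bij_betw_finite bij_betw_same_card card_Pow finite_Pow_iff)
qed

context scale
begin

definition el_monoid :: "el monoid"
  where "el_monoid = \<lparr>carrier = UNIV, monoid.mult = mul, one = unit\<rparr>"

definition G :: "nat monoid"
  where "G = transport el_monoid enc"

lemma group_el_monoid: "group el_monoid"
proof (rule groupI)
  fix x show "\<exists>y\<in>carrier el_monoid. y \<otimes>\<^bsub>el_monoid\<^esub> x = \<one>\<^bsub>el_monoid\<^esub>"
    by (rule bexI[of _ "inv_el x"]) (simp_all add: el_monoid_def inv_el_left)
qed (simp_all add: el_monoid_def mul_assoc)

lemma group_G: "group G"
  unfolding G_def by (rule group_transport[OF group_el_monoid]) (simp add: el_monoid_def inj_enc)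

lemma carrier_G: "carrier G = range enc"
  by (simp add: G_def carrier_transport el_monoid_def)

lemma one_G: "\<one>\<^bsub>G\<^esub> = enc unit"
  by (simp add: G_def one_transport el_monoid_def)

lemma mult_G: "enc x \<otimes>\<^bsub>G\<^esub> enc y = enc (mul x y)"
proof -
  have "inj_on enc (carrier el_monoid)" "monoid.mult el_monoid = mul" by (simp_all add: el_monoid_def inj_enc)
  then show ?thesis unfolding G_def using mult_transport[of enc el_monoid x y] by (simp add: el_monoid_def)
qed

lemma enc_in_G [simp]: "enc x \<in> carrier G"
  by (simp add: carrier_G)

lemma inv_G: "inv\<^bsub>G\<^esub> (enc x) = enc (inv_el x)"
  by (rule group.inv_equality[OF group_G]) (simp_all add: mult_G inv_el_left one_G)

text \<open>A normal form for \<open>eqv M J\<close>; counting its values bounds the index.\<close>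

fun res :: "int \<Rightarrow> nat \<Rightarrow> el \<Rightarrow> int \<times> (int \<Rightarrow>\<^sub>0 bit) \<times> nat set"
  where "res M J (k, f, c) = (k mod M, lin (\<lambda>k. T (k mod M)) f, {i \<in> keys c. i < J})"

lemma res_eq_iff: "res M J x = res M J y \<longleftrightarrow> eqv M J x y"
proof (cases x; cases y)
  fix k f c k' f' c' assume xy: "x = (k, f, c)" "y = (k', f', c')"
  have "{i \<in> keys c. i < J} = {i \<in> keys c'. i < J} \<longleftrightarrow> (\<forall>i<J. lookup c i = lookup c' i)"
    by (auto simp: set_eq_iff lookup_f2)
  then show ?thesis by (simp add: xy fold_eq_iff mod_eq_dvd_iff)
qed

lemma card_range_res:
  assumes "M > 0"
  shows "finite (range (res M J)) \<and> card (range (res M J)) \<le> nat M * 2 ^ nat M * 2 ^ J"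
proof -
  let ?B = "{0..<M} \<times> {f :: int \<Rightarrow>\<^sub>0 bit. keys f \<subseteq> {0..<M}} \<times> Pow {..<J}"
  have sub: "range (res M J) \<subseteq> ?B"
  proof
    fix v assume "v \<in> range (res M J)"
    then obtain k f c where "v = res M J (k, f, c)" by auto
    then show "v \<in> ?B" using keys_fold[OF assms, of f] assms by auto
  qed
  have fin: "finite ?B" using card_keys_subset[of "{0..<M}"] by simp
  have "card ?B = nat M * 2 ^ nat M * 2 ^ J"
    using card_keys_subset[of "{0..<M}"] by (simp add: card_cartesian_product card_Pow)
  then show ?thesis using card_mono[OF fin sub] finite_subset[OF sub fin] by simp
qed

lemma quotient_of_eqv:
  assumes M: "M > 0" "\<And>i. i < J \<Longrightarrow> 2 ^ \<mu> i dvd M" and sep: "\<And>h. \<not> eqv M J (mul h x) (mul y h)"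
  shows "\<exists>N. N \<lhd> G \<and> finite (rcosets\<^bsub>G\<^esub> N) \<and> card (rcosets\<^bsub>G\<^esub> N) \<le> nat M * 2 ^ nat M * 2 ^ J \<and>
    \<not> conjugate_in (G Mod N) (N #>\<^bsub>G\<^esub> enc x) (N #>\<^bsub>G\<^esub> enc y)"
proof -
  let ?\<Phi> = "\<lambda>a. res M J (the_inv enc a)"
  have \<Phi>: "?\<Phi> (enc x) = res M J x" for x by (simp add: the_inv_f_f[OF inj_enc])
  have im: "?\<Phi> ` carrier G = range (res M J)"
    unfolding carrier_G image_image \<Phi> ..
  have "\<exists>N. N \<lhd> G \<and> finite (rcosets\<^bsub>G\<^esub> N) \<and> card (rcosets\<^bsub>G\<^esub> N) \<le> card (?\<Phi> ` carrier G) \<and>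
    \<not> conjugate_in (G Mod N) (N #>\<^bsub>G\<^esub> enc x) (N #>\<^bsub>G\<^esub> enc y)"
  proof (rule group.quotient_of_congruence[OF group_G])
    show "finite (?\<Phi> ` carrier G)" unfolding im using card_range_res[OF M(1)] by blast
  next
    fix a b c d assume "a \<in> carrier G" "b \<in> carrier G" "c \<in> carrier G" "d \<in> carrier G"
      and e: "?\<Phi> a = ?\<Phi> b" "?\<Phi> c = ?\<Phi> d"
    then obtain a' b' c' d' where *: "a = enc a'" "b = enc b'" "c = enc c'" "d = enc d'"
      by (auto simp: carrier_G)
    have "eqv M J a' b'" "eqv M J c' d'" using e unfolding * \<Phi> res_eq_iff by blast+
    then have "eqv M J (mul a' c') (mul b' d')" using M(2) by (intro eqv_mul)
    then show "?\<Phi> (a \<otimes>\<^bsub>G\<^esub> c) = ?\<Phi> (b \<otimes>\<^bsub>G\<^esub> d)" unfolding * mult_G \<Phi> res_eq_iff .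
  next
    fix h assume "h \<in> carrier G"
    then obtain h' where h: "h = enc h'" by (auto simp: carrier_G)
    show "?\<Phi> (h \<otimes>\<^bsub>G\<^esub> enc x) \<noteq> ?\<Phi> (enc y \<otimes>\<^bsub>G\<^esub> h)"
      unfolding h mult_G \<Phi> res_eq_iff by (rule sep)
  qed simp_all
  then show ?thesis unfolding im using card_range_res[OF M(1), of J] by (meson le_trans)
qed

text \<open>By contraposition of \<open>conj_of_quotients\<close> one of its quotients separates.
  Those modulo \<open>k \<le> n\<close> obey the same bound since n \<le>
  \<open>2 ^ \<sigma>\<close>.\<close>

lemma separating_quotient:
  fixes n :: int
  assumes M: "\<And>i. i < J \<Longrightarrow> \<mu> i < \<sigma>" and n: "n \<ge> 1" "8 * n \<le> 2 ^ \<sigma>"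
    and J: "\<And>i. J \<le> i \<Longrightarrow> 16 * n < 2 ^ \<nu> i"
    and x: "small n x" and y: "small n y" and nc: "\<not> conjugate_in G (enc x) (enc y)"
  shows "\<exists>N. N \<lhd> G \<and> finite (rcosets\<^bsub>G\<^esub> N) \<and> card (rcosets\<^bsub>G\<^esub> N) \<le> 2 ^ \<sigma> * 2 ^ 2 ^ \<sigma> * 2 ^ J \<and>
    \<not> conjugate_in (G Mod N) (N #>\<^bsub>G\<^esub> enc x) (N #>\<^bsub>G\<^esub> enc y)"
proof -
  have nc': "mul h x \<noteq> mul y h" for h
  proof
    assume "mul h x = mul y h"
    then have "enc h \<otimes>\<^bsub>G\<^esub> enc x = enc y \<otimes>\<^bsub>G\<^esub> enc h" by (simp only: mult_G)
    then have "conjugate_in G (enc x) (enc y)"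
      using group.conjugate_in_iff[OF group_G enc_in_G enc_in_G] enc_in_G by blast
    then show False using nc by blast
  qed
  have M': "2 * 2 ^ \<mu> i dvd (2::int) ^ \<sigma>" if "i < J" for i
    using le_imp_power_dvd[of "Suc (\<mu> i)" \<sigma> "2::int"] M[OF that] by simp
  show ?thesis
  proof (cases "\<exists>h. eqv (2 ^ \<sigma>) J (mul h x) (mul y h)")
    case False
    then have ne: "\<And>h. \<not> eqv (2 ^ \<sigma>) J (mul h x) (mul y h)" by blast
    have M: "nat (2 ^ \<sigma>) = 2 ^ \<sigma>" by (simp add: nat_power_eq)
    have "(0::int) < 2 ^ \<sigma>" by simp
    moreover have "\<And>i. i < J \<Longrightarrow> 2 ^ \<mu> i dvd (2::int) ^ \<sigma>" using M' dvd_mult_right by blast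
    ultimately show ?thesis using ne unfolding M[symmetric] by (rule quotient_of_eqv)
  next
    case True
    then have "\<not> (\<forall>k. 1 \<le> k \<longrightarrow> k \<le> n \<longrightarrow> (\<exists>h. eqv k 0 (mul h x) (mul y h)))"
      using conj_of_quotients[OF M' n J x y] nc' by blast
    then obtain k where k: "1 \<le> k" "k \<le> n" "\<And>h. \<not> eqv k 0 (mul h x) (mul y h)" by blast
    have "nat k \<le> nat (2 ^ \<sigma>)" using k n by (intro nat_mono) linarith
    then have "nat k \<le> 2 ^ \<sigma>" by (simp add: nat_power_eq)
    then have "nat k * 2 ^ nat k \<le> 2 ^ \<sigma> * (2::nat) ^ 2 ^ \<sigma>"
      by (intro mult_le_mono) simp_all
    also have "\<dots> \<le> 2 ^ \<sigma> * 2 ^ 2 ^ \<sigma> * 2 ^ J" by simp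
    finally have le: "nat k * 2 ^ nat k * 2 ^ 0 \<le> 2 ^ \<sigma> * 2 ^ 2 ^ \<sigma> * (2::nat) ^ J" by simp
    have "0 < k" using k(1) by simp
    from quotient_of_eqv[OF this _ k(3)] show ?thesis using le_trans[OF _ le] by blast
  qed
qed

section \<open>Generators and word length\<close>

definition gens :: "nat set"
  where "gens = {enc (0, 1, 0), enc (1, 0, 0)}"

lemma gens_G: "finite gens" "gens \<subseteq> carrier G"
  by (auto simp: gens_def)

lemma wt_0 [simp]: "wt 0 = 0"
  by (rule poly_mapping_eqI) (simp add: lookup_wt mu_not_dvd_nu)

lemma lam_1 [simp]: "lam 1 = 0"
  using lam_T[of 0] by simp

text \<open>Position 0 carries no weight, so the lamp generator is an involution and three letters
  remain.\<close>

lemma gens_inv: "gens \<union> (\<lambda>s. inv\<^bsub>G\<^esub> s) ` gens = {enc (0, 1, 0), enc (1, 0, 0), enc (- 1, 0, 0)}"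
  by (auto simp: gens_def inv_G)

lemma generate_gens: "generate G gens = carrier G"
proof -
  interpret G: group G by (rule group_G)
  define X where "X = {x. enc x \<in> generate G gens}"
  have mulX: "mul x y \<in> X" if "x \<in> X" "y \<in> X" for x y
    using that generate.eng[of "enc x" G gens "enc y"] by (simp add: X_def mult_G)
  have invX: "inv_el x \<in> X" if "x \<in> X" for x
    using that G.generate_m_inv_closed[OF gens_G(2), of "enc x"] by (simp add: X_def inv_G)
  have aX: "(0, 1, 0) \<in> X" and tX: "(1, 0, 0) \<in> X"
    by (auto simp: X_def gens_def intro: generate.incl)
  \<comment> \<open>The generated subgroup is filled in the order shifts, single lamps, basis of the
    centre, centre, all lamps.\<close>
  have "(int k, 0, 0) \<in> X" for k
  proof (induction k)
    case 0
    then show ?case using generate.one[of G gens] by (simp add: X_def one_G)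
  next
    case (Suc k)
    then show ?case using mulX[OF Suc tX] by (simp add: add.commute)
  qed
  moreover from this have "(- int k, 0, 0) \<in> X" for k
    using invX[of "(int k, 0, 0)"] by simp
  ultimately have kX: "(k, 0, 0) \<in> X" for k by (cases k rule: int_cases2) auto
  have TX: "(0, T k, 0) \<in> X" for k
    using mulX[OF mulX[OF kX[of k] aX] kX[of "- k"]] by simp
  have "(0, 0, Poly_Mapping.single j 1) \<in> X" for j
  proof -
    let ?a = "(0, 1, 0) :: el" and ?b = "(0, T (2 ^ \<nu> j), 0) :: el"
    have "mul ?a ?b = mul (mul ?b ?a) (0, 0, Poly_Mapping.single j 1)"
      using mul_commute_base[of 1 0 "T (2 ^ \<nu> j)" 0] by (simp add: phi_pow)
    then have "mul (inv_el (mul ?b ?a)) (mul ?a ?b) = (0, 0, Poly_Mapping.single j 1)"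
      by (metis mul_inv_el_left)
    then show ?thesis using mulX[OF invX[OF mulX[OF TX aX]] mulX[OF aX TX]] by metis
  qed
  note sX = this
  have cX: "(0, 0, c) \<in> X" for c
  proof (induction c rule: f2_induct)
    case zero
    then show ?case using kX[of 0] by simp
  next
    case (add k f)
    then show ?case using mulX[OF sX[of k]] by fastforce
  qed
  have fX: "(0, f, c) \<in> X" for f c
  proof (induction f arbitrary: c rule: f2_induct)
    case zero
    then show ?case using cX by simp
  next
    case (add k f)
    \<comment> \<open>The central entry is chosen to cancel the cocycle of the product.\<close>
    have "mul (0, T k, 0) (0, f, c + lam (star (T k) * f)) \<in> X" using mulX[OF TX add.IH] .
    then show ?case by (simp add: add.assoc)
  qed
  have "(k, f, c) \<in> X" for k f c using mulX[OF fX[of f c] kX[of k]] by simp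
  then have "carrier G \<subseteq> generate G gens" by (auto simp: carrier_G X_def)
  then show ?thesis using G.generate_in_carrier[OF gens_G(2)] by blast
qed

text \<open>Letters are multiplied on the left. A shift moves the lamps by one and adds nothing
  central; a lamp at 0 adds \<open>lam f\<close>, whose coordinates satisfy n_i \<le> n by
  \<open>lam_bound\<close>.\<close>

lemma small_of_word:
  assumes "set w \<subseteq> gens \<union> (\<lambda>s. inv\<^bsub>G\<^esub> s) ` gens"
  shows "\<exists>x. foldr (\<otimes>\<^bsub>G\<^esub>) w \<one>\<^bsub>G\<^esub> = enc x \<and> small (int (length w)) x"
  using assms
proof (induction w)
  case Nil
  then show ?case by (intro exI[of _ unit]) (simp add: one_G)
next
  case (Cons a w)
  then obtain x where x: "foldr (\<otimes>\<^bsub>G\<^esub>) w \<one>\<^bsub>G\<^esub> = enc x" "small (int (length w)) x" by auto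
  obtain k f c where x': "x = (k, f, c)" by (cases x) auto
  let ?n = "int (length w)"
  have b: "\<bar>k\<bar> \<le> ?n" "keys f \<subseteq> {- ?n..?n}" "\<And>i. i \<in> keys c \<Longrightarrow> 2 ^ \<nu> i \<le> ?n"
    using x(2) by (auto simp: x')
  have l: "2 ^ \<nu> i \<le> ?n" if "i \<in> keys (lam f)" for i
    using lam_bound[OF _ that, of ?n] b(2) by fastforce
  have shift: "small (?n + 1) (k + s, T s * f, c)" if "\<bar>s\<bar> = 1" for s
  proof -
    have "keys (T s * f) \<subseteq> {- (?n + 1)..?n + 1}"
      using that by (intro order_trans[OF keys_T_interval[OF b(2)]]) auto
    moreover have "\<bar>k + s\<bar> \<le> ?n + 1" using b(1) that by linarith
    moreover have "2 ^ \<nu> i \<le> ?n + 1" if "i \<in> keys c" for i using b(3)[OF that] by linarith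
    ultimately show ?thesis by simp
  qed
  consider "a = enc (0, 1, 0)" | "a = enc (1, 0, 0)" | "a = enc (- 1, 0, 0)"
    using Cons.prems unfolding gens_inv by auto
  then show ?case
  proof cases
    case 1
    have "foldr (\<otimes>\<^bsub>G\<^esub>) (a # w) \<one>\<^bsub>G\<^esub> = enc (k, 1 + f, c + lam f)"
      using x(1) by (simp add: 1 mult_G x')
    moreover have "small (?n + 1) (k, 1 + f, c + lam f)"
    proof -
      have "keys (1 + f) \<subseteq> insert 0 (keys f)" by (auto simp: keys_add_f2)
      then have "keys (1 + f) \<subseteq> {- (?n + 1)..?n + 1}" using b(2) by fastforce
      moreover have "2 ^ \<nu> i \<le> ?n + 1" if i: "i \<in> keys (c + lam f)" for i
      proof -
        have "i \<in> keys c \<or> i \<in> keys (lam f)" using i by (auto simp: keys_add_f2)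
        then have "2 ^ \<nu> i \<le> ?n" using b(3) l by blast
        then show ?thesis by linarith
      qed
      ultimately show ?thesis using b(1) by simp
    qed
    ultimately show ?thesis by (auto simp: add.commute)
  next
    case 2
    have "foldr (\<otimes>\<^bsub>G\<^esub>) (a # w) \<one>\<^bsub>G\<^esub> = enc (k + 1, T 1 * f, c)"
      using x(1) by (simp add: 2 mult_G x' add.commute)
    then show ?thesis using shift[of 1] by (auto simp: add.commute)
  next
    case 3
    have "foldr (\<otimes>\<^bsub>G\<^esub>) (a # w) \<one>\<^bsub>G\<^esub> = enc (k + - 1, T (- 1) * f, c)"
      using x(1) by (simp add: 3 mult_G x' add.commute)
    then show ?thesis using shift[of "- 1"] by (auto simp: add.commute)
  qed
qed

lemma small_mono: "small m x \<Longrightarrow> m \<le> n \<Longrightarrow> small n x"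
  by (cases x) fastforce

lemma small_of_norm:
  assumes "a \<in> carrier G" "word_norm G gens a \<le> n"
  shows "\<exists>x. a = enc x \<and> small (int n) x"
proof -
  obtain l where "word G gens a l"
    using group.generate_word[OF group_G gens_G(2)] assms(1) generate_gens by blast
  from word_norm_word[OF this] obtain w
    where w: "set w \<subseteq> gens \<union> (\<lambda>s. inv\<^bsub>G\<^esub> s) ` gens" "length w = word_norm G gens a"
      "foldr (\<otimes>\<^bsub>G\<^esub>) w \<one>\<^bsub>G\<^esub> = a"
    unfolding word_def by blast
  then obtain x where "a = enc x" "small (int (length w)) x" using small_of_word[OF w(1)] by metis
  moreover from this(2) have "small (int n) x" by (rule small_mono) (use w(2) assms(2) in simp)
  ultimately show ?thesis by blast
qed

text \<open>For separability crude parameters do: i < n_i allows J = 16n, and a sum dominates the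
  exponents.\<close>

lemma separating_parameters:
  "\<exists>J \<sigma>. (\<forall>i<J. \<mu> i < \<sigma>) \<and> 8 * n \<le> (2::int) ^ \<sigma> \<and> (\<forall>i\<ge>J. 16 * n < 2 ^ \<nu> i)"
proof (intro exI conjI allI impI)
  let ?J = "nat (16 * n)" and ?\<sigma> = "Suc (\<Sum>i<nat (16 * n). \<mu> i) + nat (8 * n)"
  show "\<mu> i < ?\<sigma>" if "i < ?J" for i
    using member_le_sum[of i "{..<?J}" \<mu>] that by simp
  have "nat (8 * n) \<le> ?\<sigma>" by simp
  also have "?\<sigma> < 2 ^ ?\<sigma>" by (rule less_exp)
  finally have "int (nat (8 * n)) < int (2 ^ ?\<sigma>)" by (simp only: of_nat_less_iff)
  moreover have "8 * n \<le> int (nat (8 * n))" by simp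
  ultimately show "8 * n \<le> 2 ^ ?\<sigma>" unfolding of_nat_power of_nat_numeral by linarith
  show "16 * n < 2 ^ \<nu> i" if "?J \<le> i" for i
    using less_nu_pow[of i] that by linarith
qed

lemma finite_quotient_separates:
  assumes "x \<in> carrier G" "y \<in> carrier G" "\<not> conjugate_in G x y"
  shows "\<exists>N. N \<lhd> G \<and> finite (rcosets\<^bsub>G\<^esub> N) \<and>
    \<not> conjugate_in (G Mod N) (N #>\<^bsub>G\<^esub> x) (N #>\<^bsub>G\<^esub> y)"
proof -
  define n where "n = Suc (max (word_norm G gens x) (word_norm G gens y))"
  have "word_norm G gens x \<le> n" "word_norm G gens y \<le> n" by (simp_all add: n_def)
  then obtain x' y' where *: "x = enc x'" "small (int n) x'" "y = enc y'" "small (int n) y'"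
    using small_of_norm assms(1,2) by blast
  obtain J \<sigma> where J: "\<And>i. i < J \<Longrightarrow> \<mu> i < \<sigma>" "8 * int n \<le> 2 ^ \<sigma>" "\<And>i. J \<le> i \<Longrightarrow> 16 * int n < 2 ^ \<nu> i"
    using separating_parameters by blast
  have "1 \<le> int n" by (simp add: n_def)
  from separating_quotient[OF J(1) this J(2,3) *(2,4)] show ?thesis
    using assms(3) unfolding *(1,3) by blast
qed

lemma conjugacy_separable_G: "conjugacy_separable G"
  by (rule group.conjugacy_separableI[OF group_G]) (rule finite_quotient_separates)

section \<open>Upper and lower bounds for the conjugacy function\<close>

lemma Conj_fun_upper:
  assumes "\<And>i. i < J \<Longrightarrow> \<mu> i < \<sigma>" "n \<ge> 1" "8 * int n \<le> 2 ^ \<sigma>" "\<And>i. J \<le> i \<Longrightarrow> 16 * int n < 2 ^ \<nu> i"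
  shows "Conj_fun G gens n \<le> 2 ^ \<sigma> * 2 ^ 2 ^ \<sigma> * 2 ^ J"
proof (rule group.Conj_fun_le[OF group_G gens_G generate_gens])
  fix x y assume xy: "x \<in> carrier G" "y \<in> carrier G" "word_norm G gens x \<le> n" "word_norm G gens y \<le> n"
  show "Conj_elt G x y \<le> 2 ^ \<sigma> * 2 ^ 2 ^ \<sigma> * 2 ^ J"
  proof (cases "conjugate_in G x y")
    case True
    then show ?thesis by (simp add: Conj_elt_def)
  next
    case False
    obtain x' y' where *: "x = enc x'" "small (int n) x'" "y = enc y'" "small (int n) y'"
      using small_of_norm xy by blast
    then obtain N where "N \<lhd> G" "finite (rcosets\<^bsub>G\<^esub> N)" "card (rcosets\<^bsub>G\<^esub> N) \<le> 2 ^ \<sigma> * 2 ^ 2 ^ \<sigma> * 2 ^ J"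
      "\<not> conjugate_in (G Mod N) (N #>\<^bsub>G\<^esub> x) (N #>\<^bsub>G\<^esub> y)"
      using separating_quotient[of J \<sigma> "int n" x' y'] assms False by auto
    then show ?thesis using False by (intro Conj_elt_le)
  qed
qed

text \<open>The lamps at 0 and n_j are involutions, so their commutator e_j is the square of their
  product. The second is a conjugate of the first by n_j shifts, of length 2 n_j + 1.\<close>

lemma norm_single:
  "word_norm G gens (enc (0, 0, Poly_Mapping.single j 1)) \<le> 4 * 2 ^ \<nu> j + 4"
proof -
  interpret G: group G by (rule group_G)
  note wm = G.word_mult[OF gens_G(2)]
  have a: "word G gens (enc (0, 1, 0)) 1" and t: "word G gens (enc (1, 0, 0)) 1"
    and t': "word G gens (enc (- 1, 0, 0)) 1"
    using G.word_gen[OF _ gens_G(2)] unfolding gens_inv by auto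
  have tk: "word G gens (enc (int k * s, 0, 0)) k" if "s = 1 \<or> s = - 1" for s k
  proof (induction k)
    case 0
    then show ?case using G.word_one[of gens] by (simp add: one_G)
  next
    case (Suc k)
    have "word G gens (enc (s, 0, 0)) 1" using t t' that by auto
    from wm[OF this Suc] show ?case by (simp add: mult_G algebra_simps)
  qed
  let ?k = "2 ^ \<nu> j :: nat"
  have b: "word G gens (enc (0, T (2 ^ \<nu> j), 0)) (2 * ?k + 1)"
    using wm[OF wm[OF tk[of 1 ?k] a] tk[of "- 1" ?k]] by (simp add: mult_G mult_2)
  let ?a = "(0, 1, 0) :: el" and ?b = "(0, T (2 ^ \<nu> j), 0) :: el"
  have ab: "mul ?a ?b = mul (mul ?b ?a) (0, 0, Poly_Mapping.single j 1)"
    using mul_commute_base[of 1 0 "T (2 ^ \<nu> j)" 0] by (simp add: phi_pow)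
  have aa: "mul ?a ?a = unit" and bb: "mul ?b ?b = unit" by (simp_all add: T_mult lam_T)
  have "mul (mul ?a ?b) (mul ?a ?b) = mul (mul ?a ?b) (mul (mul ?b ?a) (0, 0, Poly_Mapping.single j 1))"
    by (simp only: ab)
  also have "\<dots> = mul (mul ?a (mul (mul ?b ?b) ?a)) (0, 0, Poly_Mapping.single j 1)"
    by (simp only: mul_assoc)
  also have "\<dots> = (0, 0, Poly_Mapping.single j 1)" by (simp only: aa bb mul_unit_left)
  finally have "mul (mul ?a ?b) (mul ?a ?b) = (0, 0, Poly_Mapping.single j 1)" .
  then have "word G gens (enc (0, 0, Poly_Mapping.single j 1)) (1 + (2 * ?k + 1) + (1 + (2 * ?k + 1)))"
    using wm[OF wm[OF a b] wm[OF a b]] by (simp only: mult_G)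
  from word_norm_le[OF this] show ?thesis by simp
qed

text \<open>In a quotient of order below 2^(m_j / 16) two lamp configurations on m_j / 16 positions
  coincide, and their difference forces e_j into the kernel. So e_j is hard to separate from the
  identity.\<close>

lemma Conj_fun_lower:
  assumes "4 \<le> \<mu> j" "4 * 2 ^ \<nu> j + 4 \<le> n"
  shows "2 ^ 2 ^ (\<mu> j - 4) \<le> Conj_fun G gens n"
proof -
  interpret G: group G by (rule group_G)
  let ?e = "(0, 0, Poly_Mapping.single j 1) :: el"
  have "?e \<noteq> unit" by (metis (no_types) prod.inject single_zero inj_single lookup_single_eq lookup_zero zero_neq_one)
  then have ne: "enc ?e \<noteq> \<one>\<^bsub>G\<^esub>" using inj_enc by (simp add: one_G inj_eq)
  have "2 ^ 2 ^ (\<mu> j - 4) \<le> Conj_elt G (enc ?e) \<one>\<^bsub>G\<^esub>"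
  proof (rule G.le_Conj_elt_one)
    have "\<not> conjugate_in G (enc ?e) \<one>\<^bsub>G\<^esub>" using ne by (auto simp: G.conjugate_in_iff)
    then show "\<exists>N. N \<lhd> G \<and> finite (rcosets\<^bsub>G\<^esub> N) \<and>
        \<not> conjugate_in (G Mod N) (N #>\<^bsub>G\<^esub> enc ?e) (N #>\<^bsub>G\<^esub> \<one>\<^bsub>G\<^esub>)"
      by (intro finite_quotient_separates) simp_all
  next
    fix N assume N: "N \<lhd> G" "finite (rcosets\<^bsub>G\<^esub> N)" "enc ?e \<notin> N"
    interpret N: normal N G by fact
    \<comment> \<open>The largest width that \<open>normal_contains_single\<close> admits.\<close>
    let ?D = "(2::int) ^ (\<mu> j - 4)"
    let ?F = "{f :: int \<Rightarrow>\<^sub>0 bit. keys f \<subseteq> {0..<?D}}"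
    have cF: "finite ?F" "card ?F = 2 ^ 2 ^ (\<mu> j - 4)"
      using card_keys_subset[of "{0..<?D}"] by (simp_all add: nat_power_eq)
    show "2 ^ 2 ^ (\<mu> j - 4) \<le> card (rcosets\<^bsub>G\<^esub> N)"
    proof (rule ccontr)
      assume "\<not> 2 ^ 2 ^ (\<mu> j - 4) \<le> card (rcosets\<^bsub>G\<^esub> N)"
      then have lt: "card (rcosets\<^bsub>G\<^esub> N) < card ?F" using cF by simp
      let ?c = "\<lambda>f. N #>\<^bsub>G\<^esub> enc (0, f, 0)"
      have "?c ` ?F \<subseteq> rcosets\<^bsub>G\<^esub> N" by (auto simp: RCOSETS_def intro!: bexI[OF _ enc_in_G])
      then have "card (?c ` ?F) \<le> card (rcosets\<^bsub>G\<^esub> N)" using N(2) by (intro card_mono)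
      then have "\<not> inj_on ?c ?F" using lt cF card_image[of ?c ?F] by auto
      then obtain f g where fg: "f \<in> ?F" "g \<in> ?F" "?c f = ?c g" "f \<noteq> g" by (auto simp: inj_on_def)
      have "enc (0, f, 0) \<in> N #>\<^bsub>G\<^esub> enc (0, g, 0)"
        using G.rcos_self[of "enc (0, f, 0)" N] N.subgroup_axioms fg(3) by simp
      then obtain m where m: "m \<in> N" "enc (0, f, 0) = m \<otimes>\<^bsub>G\<^esub> enc (0, g, 0)"
        by (auto simp: r_coset_def)
      then obtain m' where m': "m = enc m'" using N.subset by (auto simp: carrier_G)
      obtain k p c where kpc: "m' = (k, p, c)" by (cases m') auto
      have "(0, f, 0) = mul m' (0, g, 0)" using m(2) inj_enc unfolding m' mult_G by (simp add: inj_eq)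
      then have "k = 0" "f = p + g" by (simp_all add: kpc)
      then have p: "p = f + g" by (simp add: add.assoc)
      have "(0, 0, Poly_Mapping.single j 1) \<in> {x. enc x \<in> N}"
      proof (rule normal_contains_single)
        show "(0, p, c) \<in> {x. enc x \<in> N}" using m(1) m' kpc \<open>k = 0\<close> by simp
        show "p \<noteq> 0" using fg(4) p by simp
        show "keys p \<subseteq> {0..?D - 1}" using fg(1,2) unfolding p keys_add_f2 by auto
        have "\<mu> j = 4 + (\<mu> j - 4)" using assms by simp
        then have "(2::int) ^ \<mu> j = 2 ^ 4 * ?D" by (metis power_add)
        then show "16 * (?D - 1 - 0 + 1) \<le> 2 ^ \<mu> j" by simp
      next
        fix x y assume "x \<in> {x. enc x \<in> N}" "y \<in> {x. enc x \<in> N}"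
        then show "mul x y \<in> {x. enc x \<in> N}" using N.m_closed[of "enc x" "enc y"] by (simp add: mult_G)
      next
        fix x assume "x \<in> {x. enc x \<in> N}"
        then show "inv_el x \<in> {x. enc x \<in> N}" using N.m_inv_closed[of "enc x"] by (simp add: inv_G)
      next
        fix x g assume "x \<in> {x. enc x \<in> N}"
        then show "mul (mul g x) (inv_el g) \<in> {x. enc x \<in> N}"
          using N.inv_op_closed2[of "enc g" "enc x"] by (simp add: mult_G inv_G)
      qed
      then show False using N(3) by simp
    qed
  qed (use ne in simp_all)
  also have "\<dots> \<le> Conj_fun G gens n"
    using norm_single[of j] word_norm_le[OF G.word_one, of gens] assms(2)
    by (intro G.le_Conj_fun[OF gens_G generate_gens]) simp_all
  finally show ?thesis .
qed

end

section \<open>Growth\<close>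

lemma pow2_between:
  assumes "(x::real) \<ge> 1"
  shows "\<exists>m::nat. x \<le> 2 ^ m \<and> 2 ^ m \<le> 2 * x"
proof -
  define m where "m = (LEAST m::nat. x \<le> 2 ^ m)"
  have "\<exists>m::nat. x \<le> 2 ^ m" using real_arch_pow[of 2 x] by (auto intro: less_imp_le)
  then have 1: "x \<le> 2 ^ m" unfolding m_def by (rule LeastI_ex)
  have "2 ^ m \<le> 2 * x"
  proof (cases m)
    case (Suc k)
    have "\<not> x \<le> 2 ^ k" using not_less_Least[of k "\<lambda>m. x \<le> 2 ^ m"] Suc by (simp add: m_def)
    then show ?thesis using Suc by simp
  qed (use assms in simp)
  then show ?thesis using 1 by blast
qed

text \<open>Once ln n \<ge> max(e, 1/C), both C (ln n)^2 and the power of ln ln n are at least 1.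
  With (A) this gives F n \<ge> exp n for large n.\<close>

lemma exponent_ge:
  fixes C \<epsilon> :: real
  assumes "C > 0" "\<epsilon> > 0"
  shows "\<exists>n0\<ge>3. \<forall>n\<ge>n0. real n \<le> C * real n * (ln (real n))\<^sup>2 * ln (ln (real n)) powr (1 + \<epsilon>)"
proof -
  define n0 where "n0 = max 3 (nat \<lceil>exp (max (exp 1) (1 / C))\<rceil>)"
  have "real n \<le> C * real n * (ln (real n))\<^sup>2 * ln (ln (real n)) powr (1 + \<epsilon>)" if "n \<ge> n0" for n
  proof -
    have n: "n \<ge> 3" using that by (simp add: n0_def)
    have "exp (max (exp 1) (1 / C)) \<le> real n" using that unfolding n0_def by linarith
    then have "ln (exp (max (exp 1) (1 / C))) \<le> ln (real n)" using n by (subst ln_le_cancel_iff) auto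
    then have l: "exp 1 \<le> ln (real n)" "1 / C \<le> ln (real n)" by auto
    have "1 \<le> ln (real n)" using l(1) exp_ge_add_one_self[of 1] by linarith
    have "ln (exp 1) \<le> ln (ln (real n))" using l(1) \<open>1 \<le> ln (real n)\<close> by (subst ln_le_cancel_iff) auto
    then have "1 \<le> ln (ln (real n)) powr (1 + \<epsilon>)" using assms(2) by (simp add: ge_one_powr_ge_zero)
    moreover have "1 \<le> C * (ln (real n))\<^sup>2"
    proof -
      have "1 \<le> C * ln (real n)" using l(2) assms(1) by (simp add: field_simps)
      also have "\<dots> \<le> C * (ln (real n))\<^sup>2"
        using \<open>1 \<le> ln (real n)\<close> assms(1) by (intro mult_left_mono) (simp_all add: power2_eq_square)
      finally show ?thesis .
    qed
    ultimately have "1 * 1 \<le> C * (ln (real n))\<^sup>2 * ln (ln (real n)) powr (1 + \<epsilon>)"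
      by (intro mult_mono) auto
    then have "real n * 1 \<le> real n * (C * (ln (real n))\<^sup>2 * ln (ln (real n)) powr (1 + \<epsilon>))"
      by (intro mult_left_mono) auto
    then show ?thesis by (simp add: mult_ac)
  qed
  then show ?thesis by (intro exI[of _ n0]) (simp add: n0_def)
qed

theorem theorem1:
  fixes F :: "nat \<Rightarrow> nat"
  assumes F_pos: "\<And>n. n \<ge> 1 \<Longrightarrow> F n \<ge> 1"
    and F_mono: "mono_on {1..} F"
    and A: "\<exists>(C::real) (\<epsilon>::real). C > 0 \<and> \<epsilon> > 0 \<and>
              (\<forall>n\<ge>3. real (F n) \<ge>
                 exp (C * real n * (ln (real n))\<^sup>2 * (ln (ln (real n))) powr (1 + \<epsilon>)))"
    and B: "\<exists>(C1::real) (C2::nat). C1 > 1 \<and> C2 > 1 \<and>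
              (\<forall>n\<ge>1. real (F n) powr C1 \<le> real (F (C2 * n)))"
  shows "\<exists>(G :: nat monoid) S. group G \<and> conjugacy_separable G \<and>
           finite S \<and> S \<subseteq> carrier G \<and> generate G S = carrier G \<and>
           growth_equiv (\<lambda>n. real (F n)) (\<lambda>n. real (Conj_fun G S n))"
proof -
  \<comment> \<open>Quotient orders are exponential in m_i, so F is compared through its binary
    logarithm.\<close>
  define l where "l n = log 2 (real (F n))" for n
  have F_l: "real (F n) = 2 powr l n" if "n \<ge> 1" for n
    using F_pos[OF that] by (simp add: l_def)
  have l_mono: "l m \<le> l n" if "1 \<le> m" "m \<le> n" for m n
    using monotone_onD[OF F_mono, of m n] that F_pos[of m] by (simp add: l_def)
  have l_pos: "0 \<le> l n" if "1 \<le> n" for n using F_pos[OF that] by (simp add: l_def)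

  obtain C1 :: real and C2 :: nat where C: "C1 > 1" "C2 > 1"
    "\<And>n. n \<ge> 1 \<Longrightarrow> real (F n) powr C1 \<le> real (F (C2 * n))" using B by blast
  have l_C: "C1 * l n \<le> l (C2 * n)" if "n \<ge> 1" for n
  proof -
    have "1 \<le> C2 * n" using that C(2) by simp
    then have "2 powr (l n * C1) \<le> 2 powr l (C2 * n)"
      using C(3)[OF that] by (simp add: F_l that powr_powr)
    then show ?thesis by (simp add: mult.commute)
  qed
  have l_pow: "C1 ^ j * l n \<le> l (C2 ^ j * n)" if "n \<ge> 1" for j n
  proof (induction j)
    case (Suc j)
    have "C1 ^ Suc j * l n \<le> C1 * l (C2 ^ j * n)" using Suc C(1) by (simp add: mult.assoc)
    also have "\<dots> \<le> l (C2 * (C2 ^ j * n))" using that C(2) by (intro l_C) simp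
    finally show ?case by (simp add: mult.assoc)
  qed simp
  \<comment> \<open>Iterating (B): a constant factor on log F costs only a constant factor in the
    argument, which absorbs all constants in exponents.\<close>
  have boost: "\<exists>c\<ge>1. \<forall>n\<ge>1. K * l n \<le> l (c * n)" for K
  proof -
    obtain j where j: "K < C1 ^ j" using real_arch_pow[OF C(1)] by blast
    have "K * l n \<le> l (C2 ^ j * n)" if "n \<ge> 1" for n
    proof -
      have "K * l n \<le> C1 ^ j * l n" using j l_pos[OF that] by (intro mult_right_mono) auto
      then show ?thesis using l_pow[OF that, of j] by linarith
    qed
    then show ?thesis using C(2) by (intro exI[of _ "C2 ^ j"]) simp
  qed

  \<comment> \<open>By (A), \<open>l m\<close> \<ge> m for m \<ge> n0; rescaling by
    \<open>max 4 n0\<close> covers small n as well.\<close>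
  obtain L where L: "L \<ge> 4" "\<And>n. n \<ge> 1 \<Longrightarrow> 4 * real n \<le> l (L * n)"
  proof -
    obtain C \<epsilon> :: real where A': "C > 0" "\<epsilon> > 0"
      "\<And>n. n \<ge> 3 \<Longrightarrow> exp (C * real n * (ln (real n))\<^sup>2 * (ln (ln (real n))) powr (1 + \<epsilon>)) \<le> real (F n)"
      using A by blast
    obtain n0 where n0: "n0 \<ge> 3"
      "\<And>n. n \<ge> n0 \<Longrightarrow> real n \<le> C * real n * (ln (real n))\<^sup>2 * ln (ln (real n)) powr (1 + \<epsilon>)"
      using exponent_ge[OF A'(1,2)] by blast
    have large: "real n \<le> l n" if "n \<ge> n0" for n
    proof -
      have "exp (real n) \<le> real (F n)"
        using A'(3)[of n] n0(1) n0(2)[OF that] that by (meson exp_le_cancel_iff le_trans order.trans)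
      then have "real n \<le> ln (real (F n))" using F_pos[of n] n0(1) that by (subst ln_ge_iff) auto
      also have "\<dots> \<le> l n"
      proof -
        have "0 \<le> ln (real (F n))" using F_pos[of n] n0(1) that by (intro ln_ge_zero) auto
        moreover have "ln 2 \<le> (1::real)" using ln_add_one_self_le_self[of 1] by simp
        ultimately show ?thesis unfolding l_def log_def
          by (simp add: le_divide_eq mult_left_le)
      qed
      finally show ?thesis .
    qed
    show ?thesis
    proof (rule that[of "max 4 n0"])
      fix n :: nat assume "n \<ge> 1"
      then have "max 4 n0 * 1 \<le> max 4 n0 * n" by (intro mult_le_mono2)
      then have "real (max 4 n0 * n) \<le> l (max 4 n0 * n)" by (intro large) simp
      moreover have "4 * n \<le> max 4 n0 * n" by (intro mult_le_mono1) simp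
      ultimately show "4 * real n \<le> l (max 4 n0 * n)" by linarith
    qed simp
  qed

  \<comment> \<open>128 = 64 * 32 / 16: m_i will lie between 16 and 32 times
    \<open>l (L * 2 ^ \<nu> i)\<close> and has to grow by 64 at each step.\<close>
  obtain c where c: "c \<ge> 1" "\<And>n. n \<ge> 1 \<Longrightarrow> 128 * l n \<le> l (c * n)" using boost[of 128] by blast
  \<comment> \<open>With n_(i+1) = 2^b n_i the argument grows at least by the factor
    \<open>c\<close>.\<close>
  obtain b where b: "b \<ge> 1" "c \<le> 2 ^ b"
    using less_exp[of c] c(1) by (meson less_imp_le)
  define \<nu> where "\<nu> i = b * i" for i
  have "\<exists>m::nat. 16 * l (L * 2 ^ \<nu> i) \<le> 2 ^ m \<and> 2 ^ m \<le> 2 * (16 * l (L * 2 ^ \<nu> i))" for i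
  proof (rule pow2_between)
    have "1 \<le> (2::real) ^ \<nu> i" by simp
    moreover have "4 * (2::real) ^ \<nu> i \<le> l (L * 2 ^ \<nu> i)" using L(2)[of "2 ^ \<nu> i"] by simp
    ultimately show "1 \<le> 16 * l (L * 2 ^ \<nu> i)" by linarith
  qed
  then obtain \<mu> :: "nat \<Rightarrow> nat" where \<mu>: "\<And>i. 16 * l (L * 2 ^ \<nu> i) \<le> 2 ^ \<mu> i"
    "\<And>i. 2 ^ \<mu> i \<le> 32 * l (L * 2 ^ \<nu> i)" by (simp add: choice_iff) metis
  have pow_le: "i \<le> j" if "(2::real) ^ i \<le> 2 ^ j" for i j :: nat
    using that by simp
  \<comment> \<open>This also gives \<open>\<mu> i\<close> \<ge> 4, so that m_i / 16 is an
    integer.\<close>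
  have \<mu>_\<nu>: "\<nu> i + 6 \<le> \<mu> i" for i
  proof (rule pow_le)
    have "(2::real) ^ (\<nu> i + 6) = 16 * (4 * real (2 ^ \<nu> i))" by (simp add: power_add)
    also have "\<dots> \<le> 16 * l (L * 2 ^ \<nu> i)" by (intro mult_left_mono L(2)) auto
    also have "\<dots> \<le> 2 ^ \<mu> i" by (rule \<mu>)
    finally show "(2::real) ^ (\<nu> i + 6) \<le> 2 ^ \<mu> i" .
  qed
  interpret scale \<nu> \<mu>
  proof
    show "strict_mono \<nu>" using b(1) by (intro strict_monoI) (simp add: \<nu>_def)
    show "\<nu> i + 2 \<le> \<mu> i" for i using \<mu>_\<nu>[of i] by simp
    show "\<mu> i + 6 \<le> \<mu> (Suc i)" for i
    proof (rule pow_le)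
      let ?n = "L * 2 ^ \<nu> i"
      have "1 \<le> ?n" using L(1) by simp
      have "(2::real) ^ (\<mu> i + 6) \<le> 64 * (32 * l ?n)" using \<mu>(2)[of i] by (simp add: power_add)
      also have "\<dots> = 16 * (128 * l ?n)" by simp
      also have "\<dots> \<le> 16 * l (c * ?n)" using c(2)[OF \<open>1 \<le> ?n\<close>] by simp
      also have "\<dots> \<le> 16 * l (L * 2 ^ \<nu> (Suc i))"
      proof -
        have "c * ?n \<le> 2 ^ b * ?n" using b(2) by (rule mult_le_mono1)
        also have "\<dots> = L * 2 ^ \<nu> (Suc i)" by (simp add: \<nu>_def power_add)
        finally have "l (c * ?n) \<le> l (L * 2 ^ \<nu> (Suc i))" using c(1) \<open>1 \<le> ?n\<close> by (intro l_mono) simp_all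
        then show ?thesis by simp
      qed
      also have "\<dots> \<le> 2 ^ \<mu> (Suc i)" by (rule \<mu>)
      finally show "(2::real) ^ (\<mu> i + 6) \<le> 2 ^ \<mu> (Suc i)" .
    qed
  qed

  have "growth_le (\<lambda>n. real (F n)) (\<lambda>n. real (Conj_fun G gens n))"
    unfolding growth_le_def
  proof (intro exI[of _ "8 * 2 ^ b"] conjI allI impI)
    fix n :: nat assume n: "n \<ge> 1"
    \<comment> \<open>The first n_i \<ge> n overshoots by at most 2^b, and e_i has length at most 8
      n_i; hence the factor 8 * 2^b. The choice of m_i makes 2^(m_i / 16) at least F n.\<close>
    define i where "i = (LEAST i. n \<le> 2 ^ \<nu> i)"
    have "n \<le> 2 ^ \<nu> n" using less_nu_pow[of n] by (metis less_imp_le of_nat_le_iff of_nat_numeral of_nat_power)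
    then have i: "n \<le> 2 ^ \<nu> i" unfolding i_def by (rule LeastI)
    have i': "2 ^ \<nu> i \<le> 2 ^ b * n"
    proof (cases i)
      case 0
      then show ?thesis using n by (simp add: \<nu>_def)
    next
      case (Suc j)
      have "\<not> n \<le> 2 ^ \<nu> j" using not_less_Least[of j "\<lambda>i. n \<le> 2 ^ \<nu> i"] Suc by (simp add: i_def)
      then have "2 ^ b * 2 ^ \<nu> j \<le> 2 ^ b * n" by (intro mult_le_mono2) simp
      then show ?thesis using Suc by (simp add: \<nu>_def power_add)
    qed
    have four: "\<mu> i = 4 + (\<mu> i - 4)" using \<mu>_\<nu>[of i] by simp
    have "n * 1 \<le> 2 ^ \<nu> i * L" using i L(1) by (intro mult_le_mono) auto
    then have "l n \<le> l (L * 2 ^ \<nu> i)" using n by (intro l_mono) (simp_all add: mult.commute)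
    also have "\<dots> \<le> 2 ^ \<mu> i / 16" using \<mu>(1)[of i] by simp
    also have "\<dots> = 2 ^ (\<mu> i - 4)" by (subst four) (simp add: power_add)
    finally have "2 powr l n \<le> 2 powr real (2 ^ (\<mu> i - 4))" by simp
    then have "real (F n) \<le> 2 ^ 2 ^ (\<mu> i - 4)" using F_l[OF n] by (simp add: powr_realpow[symmetric])
    also have "\<dots> = real (2 ^ 2 ^ (\<mu> i - 4))" by simp
    also have "\<dots> \<le> real (Conj_fun G gens (8 * 2 ^ b * n))"
    proof (intro of_nat_mono Conj_fun_lower)
      have "(1::nat) \<le> 2 ^ \<nu> i" by simp
      then have "4 * 2 ^ \<nu> i + 4 \<le> 8 * (2 ^ \<nu> i :: nat)" by linarith
      also have "\<dots> \<le> 8 * (2 ^ b * n)" using i' by simp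
      finally show "4 * 2 ^ \<nu> i + 4 \<le> 8 * 2 ^ b * n" by simp
    qed (use four in linarith)
    finally show "real (F n) \<le> real (Conj_fun G gens (8 * 2 ^ b * n))" .
  qed simp
  moreover have "growth_le (\<lambda>n. real (Conj_fun G gens n)) (\<lambda>n. real (F n))"
  proof -
    \<comment> \<open>384 = 3 * 128: the index will be at most 2 to the power 3 * 2^\<sigma>, and
      2^\<sigma> \<le> 128 x.\<close>
    obtain d where d: "d \<ge> 1" "\<And>n. n \<ge> 1 \<Longrightarrow> 384 * l n \<le> l (d * n)" using boost[of 384] by blast
    show ?thesis
      unfolding growth_le_def
    proof (intro exI[of _ "d * (L * 16)"] conjI allI impI)
      show "1 \<le> d * (L * 16)" using d(1) L(1) by simp
      fix n :: nat assume n: "n \<ge> 1"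
      define x where "x = l (L * (16 * n))"
      have x: "64 * real n \<le> x" using L(2)[of "16 * n"] n by (simp add: x_def)
      then have "1 \<le> 64 * x" using n by simp
      \<comment> \<open>For i < J the moduli are at most 32 x; the extra factor 2 gives the strict
        \<open>\<mu> i < \<sigma>\<close> needed for halving the period.\<close>
      then obtain \<sigma> where \<sigma>: "64 * x \<le> 2 ^ \<sigma>" "2 ^ \<sigma> \<le> 2 * (64 * x)" using pow2_between by blast
      define J where "J = (LEAST i. 16 * n < 2 ^ \<nu> i)"
      have "16 * n < 2 ^ \<nu> (16 * n)"
        using less_nu_pow[of "16 * n"] by (metis of_nat_less_iff of_nat_numeral of_nat_power)
      then have J: "16 * n < 2 ^ \<nu> J" unfolding J_def by (rule LeastI)
      have below: "2 ^ \<nu> i \<le> 16 * n" if "i < J" for i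
        using not_less_Least[of i "\<lambda>i. 16 * n < 2 ^ \<nu> i"] that by (simp add: J_def)
      \<comment> \<open>J - 1 < n_(J-1) \<le> 16n, so the factor \<open>2 ^ J\<close> in the index
        is harmless.\<close>
      have "J \<le> 16 * n"
      proof (cases J)
        case (Suc j)
        have "int j < 2 ^ \<nu> j" by (rule less_nu_pow)
        also have "\<dots> \<le> int (16 * n)" using below[of j] Suc by (metis lessI of_nat_le_iff of_nat_numeral of_nat_power)
        finally show ?thesis using Suc by simp
      qed simp
      then have "real J \<le> 16 * real n" by linarith
      then have "real J \<le> 2 ^ \<sigma>" using x \<sigma>(1) by linarith
      then have "J \<le> 2 ^ \<sigma>" by (metis of_nat_le_iff of_nat_numeral of_nat_power)
      have "Conj_fun G gens n \<le> 2 ^ \<sigma> * 2 ^ 2 ^ \<sigma> * 2 ^ J"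
      proof (rule Conj_fun_upper)
        fix i assume "i < J"
        have "(2::real) ^ \<mu> i \<le> 32 * l (L * 2 ^ \<nu> i)" by (rule \<mu>)
        also have "\<dots> \<le> 32 * x"
        proof -
          have "L * 2 ^ \<nu> i \<le> L * (16 * n)" using below[OF \<open>i < J\<close>] by (rule mult_le_mono2)
          then show ?thesis unfolding x_def using L(1) by (intro mult_left_mono l_mono) simp_all
        qed
        also have "\<dots> < 64 * x" using x n by simp
        also have "\<dots> \<le> 2 ^ \<sigma>" by (rule \<sigma>)
        finally show "\<mu> i < \<sigma>" by simp
      next
        have "real (8 * n) \<le> 2 ^ \<sigma>" using x \<sigma>(1) by simp
        then have "8 * n \<le> 2 ^ \<sigma>" by (metis of_nat_le_iff of_nat_numeral of_nat_power)
        then show "8 * int n \<le> 2 ^ \<sigma>" by (metis of_nat_le_iff of_nat_mult of_nat_numeral of_nat_power)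
      next
        fix i assume "J \<le> i"
        have "int (16 * n) < int (2 ^ \<nu> J)" using J by (simp only: of_nat_less_iff)
        then have "16 * int n < 2 ^ \<nu> J" by simp
        also have "\<dots> \<le> 2 ^ \<nu> i" using \<open>J \<le> i\<close> by (rule nu_pow_le)
        finally show "16 * int n < 2 ^ \<nu> i" .
      qed (rule n)
      also have "\<dots> = 2 ^ (\<sigma> + 2 ^ \<sigma> + J)" by (simp add: power_add)
      also have "\<dots> \<le> 2 ^ (3 * 2 ^ \<sigma>)"
      proof (intro power_increasing)
        have "\<sigma> < 2 ^ \<sigma>" by (rule less_exp)
        then show "\<sigma> + 2 ^ \<sigma> + J \<le> 3 * 2 ^ \<sigma>" using \<open>J \<le> 2 ^ \<sigma>\<close> by linarith
      qed simp
      finally have "real (Conj_fun G gens n) \<le> real (2 ^ (3 * 2 ^ \<sigma>))" by (simp only: of_nat_le_iff)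
      also have "\<dots> = 2 powr (3 * 2 ^ \<sigma>)" by (simp add: powr_realpow[symmetric])
      also have "\<dots> \<le> 2 powr (384 * x)" using \<sigma>(2) by simp
      also have "\<dots> \<le> 2 powr (l (d * (L * (16 * n))))"
        using d(2)[of "L * (16 * n)"] L(1) n by (simp add: x_def)
      also have "\<dots> = real (F (d * (L * 16) * n))"
        using F_l[of "d * (L * (16 * n))"] d(1) L(1) n by (simp add: mult.assoc)
      finally show "real (Conj_fun G gens n) \<le> real (F (d * (L * 16) * n))" .
    qed
  qed
  ultimately show ?thesis
    using group_G conjugacy_separable_G gens_G generate_gens unfolding growth_equiv_def by blast
qed

end
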